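(* For every positive integer $d$ there is a short Presburger formula $$F(x;y) \;=\; \exists\, \mathbf{u}\;\forall\, \mathbf{v}\;\; \Psi(x,y,\mathbf{u},\mathbf{v})$$ in the class $\text{Short-PA}_{10,18}$, where $x,y$ are single integer variables ($x$ the object variable, $y$ the parameter variable), $\mathbf{u}\in\mathbb{Z}^6$, $\mathbf{v}\in\mathbb{Z}^2$, and $\Psi$ is a Boolean combination of linear inequalities, such that $$\phi(F) = O(d^2) \qquad\text{and}\qquad \mathrm{VC}(F)\ge d,$$ where the constant in $O(\cdot)$ is absolute. Moreover, $\Psi$ can be computed (from $d$) in probabilistic polynomial time in $d$.
   Context: Presburger Arithmetic (PA) is the first-order theory of the structure $(\mathbb{Z},<,+)$. The atoms of a PA-formula are linear inequalities in its variables with integer coefficients and constants, written in binary; all variables, free and quantified, range over $\mathbb{Z}$. The length $\phi(F)$ of a PA-formula $F$ is the total bit length of all symbols, operations, integer coefficients and constants in $F$. For fixed $k,t$, $\text{Short-PA}_{k,t}$ denotes the family of PA-formulas with at most $k$ variables (free and quantified variables counted together) and at most $t$ inequalities; members of such a class are called short Presburger formulas. VC-dimension: let $X$ be a set and $\mathcal{S}\subseteq 2^X$. A subset $A\subseteq X$ is shattered by $\mathcal{S}$ if for every $B\subseteq A$ there is $S\in\mathcal{S}$ with $B=S\cap A$. $\mathrm{VC}(\mathcal{S})$ is the largest size of a subset of $X$ shattered by $\mathcal{S}$ ($\infty$ if no largest size exists). For a partitioned PA-formula $F(\mathbf{x};\mathbf{y})$ with object variables $\mathbf{x}\in\mathbb{Z}^m$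 and parameter variables $\mathbf{y}\in\mathbb{Z}^n$, let $S_{b}=\{\mathbf{x}\in\mathbb{Z}^m : F(\mathbf{x};b)\text{ is true}\}$ for $b\in\mathbb{Z}^n$, let $\mathcal{S}_F=\{S_b : b\in\mathbb{Z}^n\}\subseteq 2^{\mathbb{Z}^m}$, and put $\mathrm{VC}(F)=\mathrm{VC}(\mathcal{S}_F)$. *)

theory Defs
  imports "HOL-Probability.Probability" "HOL-Computational_Algebra.Polynomial"
    "HOL-Library.Extended_Nat" "HOL-Library.Log_Nat"
begin

section \<open>Presburger formulas\<close>

text \<open>
  Variables are named by natural numbers. The atom \<^term>\<open>Ineq ts c\<close> is the linear inequality
  \<open>a\<^sub>1 x\<^sub>i\<^sub>1 + \<dots> + a\<^sub>r x\<^sub>i\<^sub>r \<le> c\<close> where \<open>ts = [(a\<^sub>1, i\<^sub>1), \<dots>, (a\<^sub>r, i\<^sub>r)]\<close>. Over the integers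
  this loses no generality: \<open>s < t\<close> is \<open>s \<le> t - 1\<close>.
\<close>

datatype pa =
    Ineq "(int \<times> nat) list" int
  | Neg pa
  | And pa pa
  | Or pa pa
  | Exists nat pa
  | Forall nat pa

primrec holds :: "(nat \<Rightarrow> int) \<Rightarrow> pa \<Rightarrow> bool" where
  "holds e (Ineq ts c) \<longleftrightarrow> (\<Sum>(a, i)\<leftarrow>ts. a * e i) \<le> c"
| "holds e (Neg F) \<longleftrightarrow> \<not> holds e F"
| "holds e (And F G) \<longleftrightarrow> holds e F \<and> holds e G"
| "holds e (Or F G) \<longleftrightarrow> holds e F \<or> holds e G"
| "holds e (Exists i F) \<longleftrightarrow> (\<exists>a. holds (e(i := a)) F)"
| "holds e (Forall i F) \<longleftrightarrow> (\<forall>a. holds (e(i := a)) F)"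

primrec quantifier_free :: "pa \<Rightarrow> bool" where
  "quantifier_free (Ineq ts c) \<longleftrightarrow> True"
| "quantifier_free (Neg F) \<longleftrightarrow> quantifier_free F"
| "quantifier_free (And F G) \<longleftrightarrow> quantifier_free F \<and> quantifier_free G"
| "quantifier_free (Or F G) \<longleftrightarrow> quantifier_free F \<and> quantifier_free G"
| "quantifier_free (Exists i F) \<longleftrightarrow> False"
| "quantifier_free (Forall i F) \<longleftrightarrow> False"

text \<open>All variables, free and quantified.\<close>

primrec vars :: "pa \<Rightarrow> nat set" where
  "vars (Ineq ts c) = snd ` set ts"
| "vars (Neg F) = vars F"
| "vars (And F G) = vars F \<union> vars G"
| "vars (Or F G) = vars F \<union> vars G"
| "vars (Exists i F) = insert i (vars F)"
| "vars (Forall i F) = insert i (vars F)"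

text \<open>Inequalities are counted with multiplicity.\<close>

primrec num_ineqs :: "pa \<Rightarrow> nat" where
  "num_ineqs (Ineq ts c) = 1"
| "num_ineqs (Neg F) = num_ineqs F"
| "num_ineqs (And F G) = num_ineqs F + num_ineqs G"
| "num_ineqs (Or F G) = num_ineqs F + num_ineqs G"
| "num_ineqs (Exists i F) = num_ineqs F"
| "num_ineqs (Forall i F) = num_ineqs F"

definition Short_PA :: "nat \<Rightarrow> nat \<Rightarrow> pa set" where
  "Short_PA k t = {F. card (vars F) \<le> k \<and> num_ineqs F \<le> t}"

section \<open>Binary notation and length\<close>

text \<open>
  Formulas are written in prefix notation as bit strings: three bits for each connective,
  quantifier or atom, and integers in binary (least significant digit first). Every binary digit
  is preceded by \<^const>\<open>True\<close> and every number closed by \<^const>\<open>False\<close>, which makes the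
  notation uniquely readable and costs only a constant factor in length.
\<close>

definition encode_nat :: "nat \<Rightarrow> bool list" where
  "encode_nat n = concat (map (\<lambda>j. [True, bit n j]) [0..<floorlog 2 n]) @ [False]"

definition encode_int :: "int \<Rightarrow> bool list" where
  "encode_int a = (a < 0) # encode_nat (nat \<bar>a\<bar>)"

primrec encode :: "pa \<Rightarrow> bool list" where
  "encode (Ineq ts c) = [False, False, False]
     @ concat (map (\<lambda>(a, i). True # encode_int a @ encode_nat i) ts) @ [False] @ encode_int c"
| "encode (Neg F) = [False, False, True] @ encode F"
| "encode (And F G) = [False, True, False] @ encode F @ encode G"
| "encode (Or F G) = [False, True, True] @ encode F @ encode G"
| "encode (Exists i F) = [True, False, False] @ encode_nat i @ encode F"
| "encode (Forall i F) = [True, False, True] @ encode_nat i @ encode F"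

definition pa_length :: "pa \<Rightarrow> nat" where
  "pa_length F = length (encode F)"

section \<open>VC-dimension\<close>

definition shatters :: "'a set set \<Rightarrow> 'a set \<Rightarrow> bool" where
  "shatters \<S> A \<longleftrightarrow> (\<forall>B\<subseteq>A. \<exists>S\<in>\<S>. B = S \<inter> A)"

text \<open>
  Subsets of shattered sets are shattered, so restricting to finite sets, on which \<^const>\<open>card\<close> is
  meaningful, does not change the supremum; it is \<open>\<infinity>\<close> if there is no largest size.
\<close>

definition VC :: "'a set \<Rightarrow> 'a set set \<Rightarrow> enat" where
  "VC X \<S> = Sup {enat (card A) |A. A \<subseteq> X \<and> finite A \<and> shatters \<S> A}"

text \<open>
  A formula is partitioned by the lists \<open>xs\<close>, \<open>ys\<close> of its object and parameter variables; points of
  \<open>\<int>\<^sup>m\<close> are integer lists of length \<open>m\<close>. The value 0 given to the remaining variables is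
  immaterial when the free variables of the formula are among \<open>xs\<close> and \<open>ys\<close>.
\<close>

definition assignment :: "nat list \<Rightarrow> int list \<Rightarrow> nat \<Rightarrow> int" where
  "assignment vs as i = (case map_of (zip vs as) i of Some a \<Rightarrow> a | None \<Rightarrow> 0)"

definition fiber :: "nat list \<Rightarrow> nat list \<Rightarrow> pa \<Rightarrow> int list \<Rightarrow> int list set" where
  "fiber xs ys F b =
     {a. length a = length xs \<and> holds (assignment (xs @ ys) (a @ b)) F}"

definition VC_formula :: "nat list \<Rightarrow> nat list \<Rightarrow> pa \<Rightarrow> enat" where
  "VC_formula xs ys F =
     VC {a. length a = length xs} {fiber xs ys F b |b. length b = length ys}"

section \<open>Probabilistic polynomial time\<close>

text \<open>
  The machine model is the random access machine with logarithmic cost and a coin-flipping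
  instruction, presented as structured programs over natural-number registers: every operation
  costs the bit length of its operands. Up to polynomial factors this agrees with probabilistic
  Turing machines. Subtraction is truncated, and division by 0 yields 0.
\<close>

type_synonym store = "nat \<Rightarrow> nat"

datatype arith =
    Const nat
  | Reg nat
  | Plus arith arith
  | Minus arith arith
  | Times arith arith
  | Div arith arith

primrec aval :: "arith \<Rightarrow> store \<Rightarrow> nat" where
  "aval (Const n) s = n"
| "aval (Reg r) s = s r"
| "aval (Plus e f) s = aval e s + aval f s"
| "aval (Minus e f) s = aval e s - aval f s"
| "aval (Times e f) s = aval e s * aval f s"
| "aval (Div e f) s = aval e s div aval f s"

abbreviation operand_cost :: "arith \<Rightarrow> store \<Rightarrow> nat" where
  "operand_cost e s \<equiv> 1 + floorlog 2 (aval e s)"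

primrec acost :: "arith \<Rightarrow> store \<Rightarrow> nat" where
  "acost (Const n) s = 1 + floorlog 2 n"
| "acost (Reg r) s = 1 + floorlog 2 (s r)"
| "acost (Plus e f) s = acost e s + acost f s + operand_cost e s + operand_cost f s"
| "acost (Minus e f) s = acost e s + acost f s + operand_cost e s + operand_cost f s"
| "acost (Times e f) s = acost e s + acost f s + operand_cost e s + operand_cost f s"
| "acost (Div e f) s = acost e s + acost f s + operand_cost e s + operand_cost f s"

datatype prog =
    Skip
  | Assign nat arith
  | Flip nat
  | Seq prog prog
  | Cond arith prog prog
  | Loop arith prog

text \<open>
  \<open>exec p s w t s'\<close>: started in store \<open>s\<close>, the program \<open>p\<close> terminates in store \<open>s'\<close> at cost \<open>t\<close>
  when its successive coin flips come out as \<open>w\<close>, all of which are used. A test succeeds iff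
  its value is nonzero.
\<close>

inductive exec :: "prog \<Rightarrow> store \<Rightarrow> bool list \<Rightarrow> nat \<Rightarrow> store \<Rightarrow> bool" where
  Skip: "exec Skip s [] 1 s"
| Assign: "exec (Assign r e) s [] (1 + acost e s) (s(r := aval e s))"
| Flip: "exec (Flip r) s [b] 1 (s(r := of_bool b))"
| Seq: "exec p s w t s' \<Longrightarrow> exec q s' w' t' s'' \<Longrightarrow> exec (Seq p q) s (w @ w') (t + t') s''"
| CondTrue: "aval e s \<noteq> 0 \<Longrightarrow> exec p s w t s' \<Longrightarrow> exec (Cond e p q) s w (1 + acost e s + t) s'"
| CondFalse: "aval e s = 0 \<Longrightarrow> exec q s w t s' \<Longrightarrow> exec (Cond e p q) s w (1 + acost e s + t) s'"
| LoopFalse: "aval e s = 0 \<Longrightarrow> exec (Loop e p) s [] (1 + acost e s) s"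
| LoopTrue: "aval e s \<noteq> 0 \<Longrightarrow> exec p s w t s' \<Longrightarrow> exec (Loop e p) s' w' t' s'' \<Longrightarrow>
    exec (Loop e p) s (w @ w') (1 + acost e s + t + t') s''"

text \<open>
  Input and output are passed in register 0. A bit string is output as the number having it as its
  binary digits, least significant first, below a leading digit 1 that marks its end.
\<close>

definition initial :: "nat \<Rightarrow> store" where
  "initial d = (\<lambda>_. 0)(0 := d)"

definition outputs :: "store \<Rightarrow> bool list \<Rightarrow> bool" where
  "outputs s w \<longleftrightarrow> s 0 = horner_sum of_bool 2 (w @ [True])"

text \<open>
  \<open>R d w\<close> says that the bit string \<open>w\<close> is an acceptable answer on input \<open>d\<close>. A single program must
  halt within a time bound polynomial in the number \<open>d\<close>, whatever the coin flips, and give an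
  acceptable answer with probability at least \<open>2/3\<close>. As a flip costs 1, a run of cost at
  most \<open>T\<close> uses at most \<open>T\<close> coins.
\<close>

definition probabilistic_poly_time :: "(nat \<Rightarrow> bool list \<Rightarrow> bool) \<Rightarrow> bool" where
  "probabilistic_poly_time R \<longleftrightarrow>
     (\<exists>(p :: prog) (P :: nat poly). \<forall>d>0.
        let T = poly P d; coins = {\<omega> :: bool list. length \<omega> = T} in
          (\<forall>\<omega>\<in>coins. \<exists>n t s. exec p (initial d) (take n \<omega>) t s \<and> t \<le> T) \<and>
          measure_pmf.prob (pmf_of_set coins)
            {\<omega>. \<exists>n t s w. exec p (initial d) (take n \<omega>) t s \<and> outputs s w \<and> R d w} \<ge> 2 / 3)"

end

theory Submission
  imports Defs "HOL-Library.Nat_Bijection"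
begin

text \<open>
  Put \<open>h = 2\<^sup>d\<close> and \<open>a = (2h)\<^sup>2\<close>, start from \<open>C\<^sub>0 = (1, 0)\<close>, \<open>D\<^sub>0 = (1, 1)\<close>, and let
  \<open>C\<^bsub>i+1\<^esub> = C\<^sub>i + a D\<^sub>i\<close> and \<open>D\<^bsub>i+1\<^esub> = D\<^sub>i + 2\<^sup>i C\<^bsub>i+1\<^esub>\<close>, as convergents of a continued fraction. With
  \<open>(q, p) = C\<^sub>d\<close> let \<open>\<delta> v = p v\<^sub>1 - q v\<^sub>2\<close>. The lattice points \<open>u\<close> with \<open>\<delta> u \<ge> 0\<close> that no \<open>v\<close> with
  \<open>0 < v\<^sub>1 \<le> u\<^sub>1\<close> beats by \<open>0 \<le> \<delta> v < \<delta> u\<close> are, in the range between \<open>C\<^sub>i\<close> and \<open>C\<^bsub>i+1\<^esub>\<close>, exactly the points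
  \<open>C\<^sub>i + j D\<^sub>i\<close>. Since \<open>2h\<close> divides \<open>a\<close>, such a point is congruent to \<open>(1 + j 2\<^sup>i, j)\<close> modulo \<open>2h\<close>; thus
  one universal quantifier block multiplies the parameter \<open>y = j\<close> by \<open>2\<^sup>i\<close>, where \<open>i\<close> is selected by the
  object \<open>x\<close>, the first coordinate of \<open>C\<^sub>i\<close>. Bit \<open>d\<close> of \<open>1 + y 2\<^sup>i\<close> is bit \<open>d - i\<close> of \<open>y\<close> when \<open>y\<close> is even,
  so all subsets of these \<open>d\<close> objects are cut out. The coefficients have \<open>O(d\<^sup>2)\<close> bits and a deterministic
  program computes them by running the recursion.
\<close>

section \<open>Convergents\<close>

text \<open>Unimodularity makes \<open>(c, d)\<close> a lattice basis, in which
  \<open>s c + t d\<close> has value \<open>s X - t Y\<close> with \<open>X, Y > 0\<close>. Every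
  competitor has \<open>s >= 1\<close>, so under a bound on the first coordinate the smallest value
  comes from \<open>s = 1\<close> with \<open>t\<close> as large as possible.\<close>

lemma record_iff:
  fixes c1 c2 d1 d2 p q a u1 u2 :: int
  assumes det: "c1 * d2 - c2 * d1 = 1" and pos: "0 < c1" "0 < d1"
    and below: "0 < p * c1 - q * c2" and above: "p * d1 - q * d2 < 0"
    and last: "0 \<le> p * (c1 + a * d1) - q * (c2 + a * d2)"
    and u: "c1 \<le> u1" "u1 \<le> c1 + a * d1"
  shows "0 \<le> p * u1 - q * u2 \<and>
      (\<forall>v1 v2. \<not> (0 < v1 \<and> v1 \<le> u1 \<and> 0 \<le> p * v1 - q * v2 \<and> p * v1 - q * v2 < p * u1 - q * u2))
    \<longleftrightarrow> (\<exists>j\<ge>0. u1 = c1 + j * d1 \<and> u2 = c2 + j * d2)" (is "?R \<longleftrightarrow> ?L")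
proof -
  define X Y where "X = p * c1 - q * c2" and "Y = q * d2 - p * d1"
  have X: "X > 0" and Y: "Y > 0" using below above by (auto simp: X_def Y_def)
  have delta: "p * (s * c1 + t * d1) - q * (s * c2 + t * d2) = s * X - t * Y" for s t
    by (simp add: X_def Y_def algebra_simps)
  have coords: "\<exists>s t. v1 = s * c1 + t * d1 \<and> v2 = s * c2 + t * d2" for v1 v2
  proof (intro exI conjI)
    have "v1 = v1 * (c1 * d2 - c2 * d1)" using det by simp
    then show "v1 = (v1 * d2 - v2 * d1) * c1 + (c1 * v2 - c2 * v1) * d1" by (simp add: algebra_simps)
    have "v2 = v2 * (c1 * d2 - c2 * d1)" using det by simp
    then show "v2 = (v1 * d2 - v2 * d1) * c2 + (c1 * v2 - c2 * v1) * d2" by (simp add: algebra_simps)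
  qed
  \<comment> \<open>For \<open>s <= 0\<close> a positive first coordinate forces
    \<open>t > 0\<close>, while a nonnegative value forces \<open>t <= 0\<close>.\<close>
  have s_pos: "s \<ge> 1" if "0 < s * c1 + t * d1" "0 \<le> s * X - t * Y" for s t
  proof (rule ccontr)
    assume "\<not> s \<ge> 1"
    then have "s * c1 \<le> 0" "s * X \<le> 0" using pos X by (auto simp: mult_le_0_iff)
    with that have "t * d1 > 0" "t * Y \<le> 0" by linarith+
    then show False using pos Y by (simp add: zero_less_mult_iff mult_le_0_iff)
  qed
  show ?thesis
  proof
    assume R: ?R
    obtain s t where st: "u1 = s * c1 + t * d1" "u2 = s * c2 + t * d2" using coords by blast
    have s: "s \<ge> 1" using R u pos unfolding st delta by (intro s_pos[of s t]) auto
    have min: "s * X - t * Y \<le> s' * X - t' * Y"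
      if "0 < s' * c1 + t' * d1" "s' * c1 + t' * d1 \<le> u1" "0 \<le> s' * X - t' * Y" for s' t'
      using R[THEN conjunct2, rule_format, of "s' * c1 + t' * d1" "s' * c2 + t' * d2"] that
      unfolding st delta by auto
    have s1: "c1 \<le> s * c1" "X \<le> s * X" using s pos X by simp_all
    \<comment> \<open>Otherwise \<open>c\<close> itself, with coordinates \<open>(1, 0)\<close>,
      beats \<open>u\<close>.\<close>
    have t: "t \<ge> 0"
    proof (rule ccontr)
      assume "\<not> t \<ge> 0"
      then have neg: "t * d1 < 0" "t * Y < 0" using pos Y by (simp_all add: mult_less_0_iff)
      then show False using min[of 1 0] s1 u pos X by simp
    qed
    \<comment> \<open>This bounds \<open>t\<close> by \<open>a\<close>, so \<open>c + t d\<close>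
      has nonnegative value and is a legitimate competitor; it forces \<open>s = 1\<close>.\<close>
    have "t * d1 \<le> a * d1" using s1 u unfolding st by linarith
    then have ta: "t * Y \<le> a * Y" using pos Y by simp
    have "t * d1 \<ge> 0" using t pos by simp
    moreover have "0 \<le> X - a * Y" using last delta[of 1 a] by simp
    ultimately have "s * X - t * Y \<le> 1 * X - t * Y"
      using s1 pos ta by (intro min) (auto simp: st)
    then have "s = 1" using s X by simp
    then show ?L using t st by auto
  next
    assume ?L
    then obtain j where j: "j \<ge> 0" "u1 = 1 * c1 + j * d1" "u2 = 1 * c2 + j * d2" by auto
    have "j * d1 \<le> a * d1" using u j by simp
    then have "j * Y \<le> a * Y" using pos Y by simp
    moreover have "0 \<le> X - a * Y" using last delta[of 1 a] by simp
    ultimately have "0 \<le> p * u1 - q * u2" unfolding j delta by simp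
    moreover have "p * u1 - q * u2 \<le> p * v1 - q * v2"
      if v: "0 < v1" "v1 \<le> u1" "0 \<le> p * v1 - q * v2" for v1 v2
    proof -
      obtain s t where st: "v1 = s * c1 + t * d1" "v2 = s * c2 + t * d2" using coords by blast
      have s: "s \<ge> 1" using v unfolding st delta by (intro s_pos)
      then have s1: "c1 \<le> s * c1" "X \<le> s * X" using pos X by simp_all
      then have "t * d1 \<le> j * d1" using v(2) unfolding st j by linarith
      then have "t * Y \<le> j * Y" using pos Y by simp
      then show ?thesis unfolding st j delta using s1 by simp
    qed
    ultimately show ?R by (meson not_less)
  qed
qed

text \<open>
  The same recursion for either coordinate of \<open>C\<^sub>i\<close> and \<open>D\<^sub>i\<close>: initial values \<open>(1, 1)\<close> give the first
  coordinates and \<open>(0, 1)\<close> the second ones.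
\<close>

fun lower upper :: "nat \<Rightarrow> nat \<Rightarrow> nat \<Rightarrow> nat \<Rightarrow> nat" where
  "lower a c d 0 = c"
| "lower a c d (Suc i) = lower a c d i + a * upper a c d i"
| "upper a c d 0 = d"
| "upper a c d (Suc i) = upper a c d i + 2 ^ i * (lower a c d i + a * upper a c d i)"

lemma upper_Suc: "upper a c d (Suc i) = upper a c d i + 2 ^ i * lower a c d (Suc i)"
  by simp

text \<open>Each step adds a multiple of one vector to the other, which preserves the
  determinant.\<close>

lemma lower_upper_det:
  "int (lower a 1 1 i) * int (upper a 0 1 i) - int (lower a 0 1 i) * int (upper a 1 1 i) = 1"
proof (induction i)
  case (Suc i)
  then show ?case by (simp add: algebra_simps)
qed simp

text \<open>The purpose of the factor \<open>2 ^ i\<close> in the recursion: modulo \<open>m\<close>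
  the value of \<open>lower\<close> is frozen at \<open>c\<close>, so \<open>upper\<close> gains the
  geometric sum \<open>1 + 2 + ... + 2 ^ (i - 1)\<close> times \<open>c\<close>. Hence
  \<open>C\<close> is congruent to \<open>(1, 0)\<close> and \<open>D\<close> to
  \<open>(2 ^ i, 1)\<close>.\<close>

lemma lower_upper_dvd:
  assumes "m dvd int a"
  shows "m dvd int (lower a c d i) - int c"
    and "m dvd int (upper a c d i) - (int d + (2 ^ i - 1) * int c)"
proof (induction i)
  case (Suc i)
  {
    case 1
    have "int (lower a c d (Suc i)) - int c = (int (lower a c d i) - int c) + int a * int (upper a c d i)"
      by simp
    then show ?case using Suc(1) assms by (metis dvd_add dvd_mult2)
  next
    case 2
    have "m dvd int (lower a c d (Suc i)) - int c"
    proof -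
      have "int (lower a c d (Suc i)) - int c = (int (lower a c d i) - int c) + int a * int (upper a c d i)"
        by simp
      then show ?thesis using Suc(1) assms by (metis dvd_add dvd_mult2)
    qed
    moreover have "int (upper a c d (Suc i)) - (int d + (2 ^ Suc i - 1) * int c)
      = (int (upper a c d i) - (int d + (2 ^ i - 1) * int c)) + 2 ^ i * (int (lower a c d (Suc i)) - int c)"
      by (simp only: upper_Suc of_nat_add of_nat_mult of_nat_power of_nat_numeral) (simp add: algebra_simps)
    ultimately show ?case using Suc(2) by (metis dvd_add dvd_mult)
  }
qed simp_all

section \<open>Growth of the convergents and their order by slope\<close>

lemma lower_pos: "0 < c \<Longrightarrow> 0 < lower a c d i"
  by (induction i) auto

lemma upper_pos: "0 < d \<Longrightarrow> 0 < upper a c d i"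
  by (induction i) auto

text \<open>Together with \<open>upper_le_lower\<close> this lets the formula delimit the range by
  \<open>a * x\<close>, which mentions only the object: the present bound keeps \<open>a * x\<close>
  below the next convergent, the other leaves room for all \<open>j < 2 h\<close>.\<close>

lemma lower_le_upper: "lower a 1 1 i \<le> upper a 1 1 i"
  by (cases i) (auto simp: trans_le_add2)

lemma upper_le_lower:
  assumes "0 < a"
  shows "upper a 1 1 i \<le> 2 ^ i * lower a 1 1 i"
proof (cases i)
  case (Suc k)
  have "upper a 1 1 k \<le> lower a 1 1 (Suc k)" using assms by (simp add: trans_le_add2)
  also have "\<dots> \<le> 2 ^ k * lower a 1 1 (Suc k)" by simp
  finally show ?thesis unfolding Suc upper_Suc by (simp del: lower.simps)
qed simp

text \<open>One step multiplies \<open>upper\<close> by at most \<open>1 + 2 ^ i * (1 + a)\<close>,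
  hence by at most \<open>(2 * b) ^ 3\<close>; with \<open>b = 2 ^ d\<close>, \<open>d\<close> steps
  produce only \<open>O(d^2)\<close> bits.\<close>

lemma upper_bound:
  assumes "2 ^ i \<le> b" "2 \<le> b" "a = (2 * b) ^ 2"
  shows "upper a 1 1 i \<le> (2 * b) ^ (3 * i)"
  using assms(1)
proof (induction i)
  case (Suc i)
  let ?u = "upper a 1 1 i"
  have *: "1 + 2 ^ i * (1 + a) \<le> (2 * b) ^ 3"
  proof -
    have "2 ^ i * (1 + a) \<le> b * (1 + a)"
      using Suc.prems by (intro mult_right_mono) simp_all
    then have "1 + 2 ^ i * (1 + a) \<le> 1 + b * (1 + a)"
      by simp
    also have "\<dots> \<le> (2 * b) ^ 3"
    proof -
      have "b * 1 \<le> b * (b * b)" "1 \<le> b * (b * b)" using assms(2) by simp_all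
      moreover have "1 + b * (1 + a) = 1 + b + 4 * (b * (b * b))" "(2 * b) ^ 3 = 8 * (b * (b * b))"
        using assms(3) by (simp_all add: power2_eq_square power3_eq_cube algebra_simps)
      ultimately show ?thesis by linarith
    qed
    finally show ?thesis .
  qed
  have "upper a 1 1 (Suc i) \<le> ?u + 2 ^ i * (?u + a * ?u)"
    using lower_le_upper[of a i] by simp
  also have "\<dots> = (1 + 2 ^ i * (1 + a)) * ?u" by (simp add: algebra_simps)
  also have "\<dots> \<le> (2 * b) ^ 3 * (2 * b) ^ (3 * i)"
    using * Suc by (intro mult_mono) auto
  finally show ?case by (simp only: power_add[symmetric] mult_Suc_right)
qed simp

lemma lower_upper_mono:
  assumes "c \<le> c'" "d \<le> d'"
  shows "lower a c d i \<le> lower a c' d' i" "upper a c d i \<le> upper a c' d' i"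
  by (induction i) (auto intro!: add_mono mult_mono assms simp del: add_mult_distrib2)

text \<open>\<open>lo\<close> and \<open>up\<close> are cross products with the \<open>k\<close>-th
  \<open>C\<close> and \<open>D\<close>. Later vectors are nonnegative combinations of earlier ones,
  so they stay in the cone spanned by \<open>C\<close> and \<open>D\<close> of index
  \<open>i\<close>. At \<open>n = 0\<close> the signs come from the determinant.\<close>

lemma convergent_slopes_aux:
  fixes a i n :: nat
  assumes "0 < a"
  defines "lo \<equiv> \<lambda>k u v. int (lower a 0 1 k) * int u - int (lower a 1 1 k) * int v"
    and "up \<equiv> \<lambda>k u v. int (upper a 0 1 k) * int u - int (upper a 1 1 k) * int v"
  shows "0 \<le> lo (i + n) (lower a 1 1 i) (lower a 0 1 i) \<and> 0 < up (i + n) (lower a 1 1 i) (lower a 0 1 i)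
    \<and> lo (i + n) (upper a 1 1 i) (upper a 0 1 i) < 0 \<and> up (i + n) (upper a 1 1 i) (upper a 0 1 i) \<le> 0"
proof (induction n)
  case 0
  show ?case using lower_upper_det[of a i]
    by (simp add: lo_def up_def algebra_simps)
next
  case (Suc n)
  have "lo (i + Suc n) u v = lo (i + n) u v + int a * up (i + n) u v"
    "up (i + Suc n) u v = up (i + n) u v + 2 ^ (i + n) * lo (i + Suc n) u v" for u v
    by (simp_all add: lo_def up_def algebra_simps)
  then show ?case using Suc assms(1)
    by (auto simp: mult_le_0_iff mult_less_0_iff add_pos_nonneg add_neg_nonpos intro!: add_nonpos_nonpos)
qed

text \<open>Strictness at index \<open>i\<close> comes from the step that adds \<open>a\<close>
  times the \<open>up\<close> term. At index \<open>i + 1\<close> only \<open>0 <=\<close> can be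
  claimed, since \<open>i + 1 = k\<close> is possible and gives 0.\<close>

lemma convergent_slopes:
  fixes a i k :: nat
  assumes "i < k" "0 < a"
  defines "\<delta> \<equiv> \<lambda>u v. int (lower a 0 1 k) * int u - int (lower a 1 1 k) * int v"
  shows "0 < \<delta> (lower a 1 1 i) (lower a 0 1 i)"
    and "\<delta> (upper a 1 1 i) (upper a 0 1 i) < 0"
    and "0 \<le> \<delta> (lower a 1 1 (Suc i)) (lower a 0 1 (Suc i))"
proof -
  obtain n where k: "k = Suc (i + n)" using less_imp_Suc_add[OF assms(1)] by blast
  let ?u = "lower a 1 1 i" and ?v = "lower a 0 1 i"
  have "\<delta> ?u ?v = (int (lower a 0 1 (i + n)) * int ?u - int (lower a 1 1 (i + n)) * int ?v)
     + int a * (int (upper a 0 1 (i + n)) * int ?u - int (upper a 1 1 (i + n)) * int ?v)"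
    by (simp add: k \<delta>_def algebra_simps)
  then show "0 < \<delta> ?u ?v"
    using convergent_slopes_aux[OF assms(2), of i n] assms(2) by (simp add: add_nonneg_pos)
  show "\<delta> (upper a 1 1 i) (upper a 0 1 i) < 0"
    using convergent_slopes_aux[OF assms(2), of i "Suc n"] by (simp add: k \<delta>_def)
  show "0 \<le> \<delta> (lower a 1 1 (Suc i)) (lower a 0 1 (Suc i))"
    using convergent_slopes_aux[OF assms(2), of "Suc i" n] by (simp only: k \<delta>_def add_Suc)
qed

section \<open>The formula and its VC-dimension\<close>

text \<open>
  In a template, the coefficient \<open>r\<close> or \<open>-r\<close> stands for plus or minus the content of register \<open>r\<close>.
  Register 0 cannot be used this way, as it has no sign.
\<close>

primrec instantiate :: "(nat \<Rightarrow> nat) \<Rightarrow> pa \<Rightarrow> pa" where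
  "instantiate s (Ineq ts c) =
     Ineq (map (\<lambda>(a, i). (sgn a * int (s (nat \<bar>a\<bar>)), i)) ts) (sgn c * int (s (nat \<bar>c\<bar>)))"
| "instantiate s (Neg F) = Neg (instantiate s F)"
| "instantiate s (And F G) = And (instantiate s F) (instantiate s G)"
| "instantiate s (Or F G) = Or (instantiate s F) (instantiate s G)"
| "instantiate s (Exists i F) = Exists i (instantiate s F)"
| "instantiate s (Forall i F) = Forall i (instantiate s F)"

primrec coeffs_of :: "pa \<Rightarrow> int set" where
  "coeffs_of (Ineq ts c) = insert c (fst ` set ts)"
| "coeffs_of (Neg F) = coeffs_of F"
| "coeffs_of (And F G) = coeffs_of F \<union> coeffs_of G"
| "coeffs_of (Or F G) = coeffs_of F \<union> coeffs_of G"
| "coeffs_of (Exists i F) = coeffs_of F"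
| "coeffs_of (Forall i F) = coeffs_of F"

section \<open>Serialising a formula whose coefficients sit in registers\<close>

datatype item = Bits "bool list" | Num nat

primrec item_bits :: "(nat \<Rightarrow> nat) \<Rightarrow> item \<Rightarrow> bool list" where
  "item_bits s (Bits bs) = bs"
| "item_bits s (Num r) = encode_nat (s r)"

primrec items :: "pa \<Rightarrow> item list" where
  "items (Ineq ts c) = [Bits [False, False, False]]
     @ concat (map (\<lambda>(a, i). [Bits [True, a < 0], Num (nat \<bar>a\<bar>), Bits (encode_nat i)]) ts)
     @ [Bits [False, c < 0], Num (nat \<bar>c\<bar>)]"
| "items (Neg F) = Bits [False, False, True] # items F"
| "items (And F G) = Bits [False, True, False] # items F @ items G"
| "items (Or F G) = Bits [False, True, True] # items F @ items G"
| "items (Exists i F) = Bits ([True, False, False] @ encode_nat i) # items F"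
| "items (Forall i F) = Bits ([True, False, True] @ encode_nat i) # items F"

text \<open>The template fixes every sign bit in advance. For a negative coefficient this is right
  only when its register is nonzero, because 0 is encoded with the nonnegative sign.\<close>

lemma encode_instantiate:
  assumes "\<And>a. a \<in> coeffs_of F \<Longrightarrow> a \<noteq> 0 \<and> (a < 0 \<longrightarrow> 0 < s (nat \<bar>a\<bar>))"
  shows "encode (instantiate s F) = concat (map (item_bits s) (items F))"
  using assms
proof (induction F)
  case (Ineq ts c)
  have int: "encode_int (sgn a * int (s (nat \<bar>a\<bar>))) = (a < 0) # encode_nat (s (nat \<bar>a\<bar>))"
    if "a \<in> coeffs_of (Ineq ts c)" for a
    using Ineq[OF that] by (cases "a < 0") (auto simp: encode_int_def)
  have "concat (map (\<lambda>(a, i). True # encode_int (sgn a * int (s (nat \<bar>a\<bar>))) @ encode_nat i) us)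
    = concat (map (item_bits s) (concat (map (\<lambda>(a, i). [Bits [True, a < 0], Num (nat \<bar>a\<bar>), Bits (encode_nat i)]) us)))"
    if "set us \<subseteq> set ts" for us
    using that
  proof (induction us)
    case (Cons t us)
    obtain a i where t: "t = (a, i)" by (cases t)
    then have "a \<in> coeffs_of (Ineq ts c)" using Cons.prems by force
    then show ?case using Cons by (simp add: t int)
  qed simp
  from this[OF subset_refl] show ?case
    by (simp add: int comp_def case_prod_unfold)
qed auto

text \<open>
  Register 3 holds \<open>h = 2\<^sup>d\<close>, 4 holds \<open>2h\<close>, 5 holds \<open>a = (2h)\<^sup>2\<close>, registers 6 and 7 hold the direction
  \<open>(q, p)\<close>, and 11 and 12 the constants 1 and 0. With \<open>\<delta> v = p v\<^sub>1 - q v\<^sub>2\<close>, \<open>u = (x\<^sub>2, x\<^sub>3)\<close> and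
  \<open>v = (x\<^sub>8, x\<^sub>9)\<close>, the conjuncts say \<open>x \<le> u\<^sub>1 \<le> a x\<close>; \<open>u\<^sub>2 = y + 2h x\<^sub>4\<close>; \<open>2h x\<^sub>5 + h \<le> u\<^sub>1 < 2h x\<^sub>5 + 2h\<close>;
  \<open>0 \<le> \<delta> u\<close>; and that not \<open>0 < v\<^sub>1 \<le> u\<^sub>1\<close> and \<open>0 \<le> \<delta> v < \<delta> u\<close>. The variables \<open>x\<^sub>6\<close> and \<open>x\<^sub>7\<close> are idle.
\<close>

definition template :: pa where
  "template =
     And (Ineq [(11, 0), (-11, 2)] 12)
    (And (Ineq [(11, 2), (-5, 0)] 12)
    (And (Ineq [(11, 3), (-4, 4), (-11, 1)] 12)
    (And (Ineq [(11, 1), (4, 4), (-11, 3)] 12)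
    (And (Ineq [(4, 5), (-11, 2)] (-3))
    (And (Neg (Ineq [(4, 5), (-11, 2)] (-4)))
    (And (Ineq [(6, 3), (-7, 2)] 12)
         (Neg (And (Ineq [(-11, 8)] (-11))
              (And (Ineq [(11, 8), (-11, 2)] 12)
              (And (Ineq [(6, 9), (-7, 8)] 12)
                   (Neg (Ineq [(7, 2), (-6, 3), (-7, 8), (6, 9)] 12))))))))))))"

definition regs :: "nat \<Rightarrow> nat \<Rightarrow> nat \<Rightarrow> nat \<Rightarrow> nat" where
  "regs h q p = (\<lambda>_. 0)(3 := h, 4 := 2 * h, 5 := (2 * h) ^ 2, 6 := q, 7 := p, 11 := 1)"

abbreviation (input) quantified :: "pa \<Rightarrow> pa" where
  "quantified \<Psi> \<equiv> foldr Exists [2..<8] (foldr Forall [8..<10] \<Psi>)"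

lemma quantified_eq:
  "quantified \<Psi> = Exists 2 (Exists 3 (Exists 4 (Exists 5 (Exists 6 (Exists 7 (Forall 8 (Forall 9 \<Psi>)))))))"
  by (simp add: upt_rec)

lemma instantiate_template_shape:
  shows "quantifier_free (instantiate s template)" "vars (instantiate s template) \<subseteq> {..<10}"
    "quantified (instantiate s template) \<in> Short_PA 10 18"
proof -
  show qf: "quantifier_free (instantiate s template)" and v: "vars (instantiate s template) \<subseteq> {..<10}"
    by (auto simp: template_def)
  have "vars (quantified (instantiate s template)) \<subseteq> {..<10}"
    using v by (simp add: quantified_eq)
  then have "card (vars (quantified (instantiate s template))) \<le> card {..<10::nat}"
    by (intro card_mono) auto
  then show "quantified (instantiate s template) \<in> Short_PA 10 18"
    by (simp add: Short_PA_def quantified_eq template_def)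
qed

section \<open>Length and meaning of the quantified formula\<close>

lemma length_encode_nat: "length (encode_nat n) = 2 * floorlog 2 n + 1"
proof -
  have "length (concat (map (\<lambda>j. [True, f j]) xs)) = 2 * length xs" for f and xs :: "nat list"
    by (induction xs) auto
  then show ?thesis by (simp add: encode_nat_def)
qed

lemma floorlog_2_le: "floorlog 2 n \<le> n"
  by (simp add: floorlog_le_iff)

text \<open>The template has 36 integer slots of at most \<open>2 * b + 2\<close> bits each; all
  else has constant length.\<close>

lemma length_encode_template:
  assumes "\<And>r. floorlog 2 (s r) \<le> b"
  shows "pa_length (quantified (instantiate s template)) \<le> 1000 + 100 * b"
proof -
  have num: "length (encode_int (sgn a * int (s (nat \<bar>a\<bar>)))) \<le> 2 * b + 2" for a
    using assms[of "nat \<bar>a\<bar>"] by (auto simp: encode_int_def length_encode_nat abs_mult sgn_if floorlog_def)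
  have var: "length (encode_nat i) \<le> 2 * i + 1" for i
    using floorlog_2_le[of i] by (simp add: length_encode_nat)
  note bounds = num[of 11] num[of "-11"] num[of 12] num[of 7] num[of "-7"] num[of 6] num[of "-6"]
      num[of 4] num[of "-4"] num[of "-5"] num[of "-3"]
      var[of 0] var[of 1] var[of 2] var[of 3] var[of 4] var[of 5] var[of 6] var[of 7] var[of 8] var[of 9]
  show ?thesis
    unfolding quantified_eq template_def pa_length_def
    using bounds by simp
qed

lemma holds_template:
  "holds e (quantified (instantiate (regs h q p) template)) \<longleftrightarrow>
    (\<exists>u1 u2. e 0 \<le> u1 \<and> u1 \<le> (2 * int h) ^ 2 * e 0 \<and> (\<exists>w. u2 = e 1 + 2 * int h * w)
      \<and> (\<exists>w. 2 * int h * w + int h \<le> u1 \<and> u1 < 2 * int h * w + 2 * int h)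
      \<and> (0 \<le> int p * u1 - int q * u2
      \<and> (\<forall>v1 v2. \<not> (0 < v1 \<and> v1 \<le> u1 \<and> 0 \<le> int p * v1 - int q * v2
           \<and> int p * v1 - int q * v2 < int p * u1 - int q * u2))))"
  (is "_ \<longleftrightarrow> ?R")
proof -
  \<comment> \<open>Literal reading of the template: \<open>w1\<close>, \<open>w2\<close> are
    variables 4 and 5, \<open>z1\<close>, \<open>z2\<close> variables 6 and 7, and the equation for
    \<open>u2\<close> appears as two inequalities.\<close>
  have "holds e (quantified (instantiate (regs h q p) template)) \<longleftrightarrow>
    (\<exists>u1 u2 w1 w2 (z1 :: int) (z2 :: int). \<forall>v1 v2. e 0 \<le> u1 \<and> u1 \<le> (2 * int h) ^ 2 * e 0 \<and> (u2 \<le> e 1 + 2 * int h * w1)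
     \<and> e 1 + 2 * int h * w1 \<le> u2
      \<and> 2 * int h * w2 + int h \<le> u1 \<and> u1 < 2 * int h * w2 + 2 * int h
      \<and> 0 \<le> int p * u1 - int q * u2
      \<and> \<not> (0 < v1 \<and> v1 \<le> u1 \<and> 0 \<le> int p * v1 - int q * v2
           \<and> int p * v1 - int q * v2 < int p * u1 - int q * u2))"
    unfolding quantified_eq template_def
    by (simp add: regs_def algebra_simps int_one_le_iff_zero_less not_less) (simp add: not_le)
  also have "\<dots> \<longleftrightarrow> ?R"
    by (auto simp: order_eq_iff)
  finally show ?thesis .
qed

section \<open>Shattering \<open>d\<close> objects by means of one binary digit\<close>

lemma VC_ge:
  assumes "A \<subseteq> X" "finite A" "shatters S A" "d \<le> card A"
  shows "VC X S \<ge> enat d"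
  unfolding VC_def
  by (rule order.trans[OF _ Sup_upper, of _ "enat (card A)"]) (use assms in auto)


text \<open>For \<open>h = 2 ^ d\<close> the windows cover exactly the numbers whose binary digit
  \<open>d\<close> is 1, which makes that digit accessible linearly with one existential
  variable.\<close>

lemma window_iff_odd:
  assumes "0 < h"
  shows "(\<exists>w. 2 * int h * w + int h \<le> int m \<and> int m < 2 * int h * w + 2 * int h) \<longleftrightarrow> odd (m div h)"
proof -
  have "(\<exists>w. 2 * int h * w + int h \<le> int m \<and> int m < 2 * int h * w + 2 * int h) \<longleftrightarrow>
    (\<exists>w. int m div int h = 2 * w + 1)"
  proof (rule ex_cong1)
    fix w
    have "int m div int h = 2 * w + 1 \<longleftrightarrow> (2 * w + 1) * int h \<le> int m \<and> int m < (2 * w + 1 + 1) * int h"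
    proof
      assume "int m div int h = 2 * w + 1"
      then obtain r where "int m = (2 * w + 1) * int h + r" "0 \<le> r" "r < int h"
        using assms pos_mod_bound[of "int h" "int m"] pos_mod_sign[of "int h" "int m"]
        by (metis div_mult_mod_eq of_nat_0_less_iff)
      then show "(2 * w + 1) * int h \<le> int m \<and> int m < (2 * w + 1 + 1) * int h"
        by (simp add: distrib_right)
    next
      assume "(2 * w + 1) * int h \<le> int m \<and> int m < (2 * w + 1 + 1) * int h"
      then show "int m div int h = 2 * w + 1"
        by (intro int_div_pos_eq[of _ _ _ "int m - (2 * w + 1) * int h"]) (auto simp: algebra_simps)
    qed
    then show "(2 * int h * w + int h \<le> int m \<and> int m < 2 * int h * w + 2 * int h) \<longleftrightarrow> int m div int h = 2 * w + 1"
      by (simp add: algebra_simps)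
  qed
  also have "\<dots> \<longleftrightarrow> odd (int m div int h)" by (auto elim: oddE)
  finally show ?thesis by (simp add: zdiv_int[symmetric])
qed

text \<open>The windows have period \<open>2 * h\<close>, so a multiple of it is absorbed by
  shifting \<open>w\<close>.\<close>

lemma window_cong:
  fixes m n :: int
  assumes "2 * int h dvd m - n" "2 * int h * w + int h \<le> m \<and> m < 2 * int h * w + 2 * int h"
  shows "\<exists>w. 2 * int h * w + int h \<le> n \<and> n < 2 * int h * w + 2 * int h"
proof -
  obtain k where "m - n = 2 * int h * k" using assms(1) by blast
  then show ?thesis using assms(2) by (intro exI[of _ "w - k"]) (simp add: algebra_simps)
qed

text \<open>The direction is \<open>C\<close> of index \<open>d\<close>, so
  \<open>convergent_slopes\<close> applies with \<open>k = d\<close> to each of the \<open>d\<close>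
  earlier convergents, and these can serve as objects.\<close>

definition formula :: "nat \<Rightarrow> pa" where
  "formula d = instantiate
     (regs (2 ^ d) (lower ((2 * 2 ^ d) ^ 2) 1 1 d) (lower ((2 * 2 ^ d) ^ 2) 0 1 d)) template"

text \<open>The record condition leaves the points \<open>C + j D\<close>; the congruence for
  \<open>u2\<close> fixes \<open>j\<close>, hence also \<open>u1\<close>, modulo \<open>2 h\<close>,
  and the window reads digit \<open>d\<close> of \<open>u1\<close>.\<close>

lemma holds_formula:
  fixes d i y :: nat
  defines "h \<equiv> 2 ^ d :: nat"
  defines "a \<equiv> (2 * h) ^ 2"
  assumes i: "i < d" and y: "y < 2 * h" and e: "e 0 = int (lower a 1 1 i)" "e 1 = int y"
  shows "holds e (quantified (formula d)) \<longleftrightarrow> odd ((1 + 2 ^ i * y) div h)"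
proof -
  let ?p = "lower a 0 1 d" and ?q = "lower a 1 1 d"
  let ?c1 = "lower a 1 1 i" and ?c2 = "lower a 0 1 i"
  let ?d1 = "upper a 1 1 i" and ?d2 = "upper a 0 1 i"
  let ?W = "\<lambda>m. \<exists>w. 2 * int h * w + int h \<le> m \<and> m < 2 * int h * w + 2 * int h"
  have h: "h > 0" and a: "a > 0" by (simp_all add: h_def a_def)
  have le: "?c1 \<le> ?d1" by (rule lower_le_upper)
  have pos: "0 < ?c1" "0 < ?d1" by (simp_all add: lower_pos upper_pos)
  have dvd: "2 * int h dvd int a" by (simp add: a_def power2_eq_square)
  \<comment> \<open>Instances \<open>c = 0\<close> and \<open>c = 1\<close> of
    \<open>lower_upper_dvd\<close>: the second coordinates of \<open>C\<close> and \<open>D\<close>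
    reduce to 0 and 1, the first ones to 1 and \<open>2 ^ i\<close>.\<close>
  have cong: "2 * int h dvd (int ?c2 + j * int ?d2) - j"
    "2 * int h dvd (int ?c1 + j * int ?d1) - (1 + 2 ^ i * j)" for j
  proof -
    have "(int ?c2 + j * int ?d2) - j = (int ?c2 - int 0) + j * (int ?d2 - (int 1 + (2 ^ i - 1) * int 0))"
      by (simp add: algebra_simps)
    then show "2 * int h dvd (int ?c2 + j * int ?d2) - j"
      using lower_upper_dvd[OF dvd, of 0 1 i] by (metis dvd_add dvd_mult)
    have "(int ?c1 + j * int ?d1) - (1 + 2 ^ i * j)
      = (int ?c1 - int 1) + j * (int ?d1 - (int 1 + (2 ^ i - 1) * int 1))"
      by (simp add: algebra_simps)
    then show "2 * int h dvd (int ?c1 + j * int ?d1) - (1 + 2 ^ i * j)"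
      using lower_upper_dvd[OF dvd, of 1 1 i] by (metis dvd_add dvd_mult)
  qed
  note slopes = convergent_slopes[OF i a]
  have records: "0 \<le> int ?p * u1 - int ?q * u2 \<and>
      (\<forall>v1 v2. \<not> (0 < v1 \<and> v1 \<le> u1 \<and> 0 \<le> int ?p * v1 - int ?q * v2
        \<and> int ?p * v1 - int ?q * v2 < int ?p * u1 - int ?q * u2))
    \<longleftrightarrow> (\<exists>j\<ge>0. u1 = int ?c1 + j * int ?d1 \<and> u2 = int ?c2 + j * int ?d2)"
    if "int ?c1 \<le> u1" "u1 \<le> (2 * int h) ^ 2 * int ?c1" for u1 u2
  proof (rule record_iff)
    show "int ?c1 * int ?d2 - int ?c2 * int ?d1 = 1" by (rule lower_upper_det)
    show "0 \<le> int ?p * (int ?c1 + int a * int ?d1) - int ?q * (int ?c2 + int a * int ?d2)"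
      using slopes(3) by simp
    have "(2 * int h) ^ 2 * int ?c1 \<le> int a * int ?d1"
    proof -
      have "(2 * int h) ^ 2 = int a" by (simp add: a_def)
      moreover have "int a * int ?c1 \<le> int a * int ?d1" using le by (intro mult_left_mono) auto
      ultimately show ?thesis by (simp only:)
    qed
    then show "u1 \<le> int ?c1 + int a * int ?d1" using that by linarith
  qed (use slopes pos that in simp_all)
  have "holds e (quantified (formula d)) \<longleftrightarrow> (\<exists>u1 u2. int ?c1 \<le> u1 \<and> u1 \<le> (2 * int h) ^ 2 * int ?c1
      \<and> (\<exists>w. u2 = int y + 2 * int h * w) \<and> ?W u1
      \<and> (\<exists>j\<ge>0. u1 = int ?c1 + j * int ?d1 \<and> u2 = int ?c2 + j * int ?d2))"
    unfolding formula_def holds_template h_def[symmetric] a_def[symmetric] e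
    by (intro ex_cong1 conj_cong refl records)
  also have "\<dots> \<longleftrightarrow> ?W (1 + 2 ^ i * int y)"
  proof
    assume "\<exists>u1 u2. int ?c1 \<le> u1 \<and> u1 \<le> (2 * int h) ^ 2 * int ?c1
      \<and> (\<exists>w. u2 = int y + 2 * int h * w) \<and> ?W u1
      \<and> (\<exists>j\<ge>0. u1 = int ?c1 + j * int ?d1 \<and> u2 = int ?c2 + j * int ?d2)"
    then obtain u1 u2 j w where u: "u1 = int ?c1 + j * int ?d1" "u2 = int ?c2 + j * int ?d2"
      "u2 = int y + 2 * int h * w" and "?W u1" by blast
    then have j: "int ?c2 + j * int ?d2 = int y + 2 * int h * w"
      and W: "?W (int ?c1 + j * int ?d1)" by simp_all
    \<comment> \<open>\<open>j\<close> need not equal \<open>y\<close>; agreement modulo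
      \<open>2 h\<close> suffices because the windows are periodic.\<close>
    have "2 * int h dvd j - int y"
    proof -
      have "j - int y = 2 * int h * w - ((int ?c2 + j * int ?d2) - j)" using j by simp
      then show ?thesis using cong(1) by (metis dvd_diff dvd_triv_left)
    qed
    then have "2 * int h dvd ((int ?c1 + j * int ?d1) - (1 + 2 ^ i * j)) + 2 ^ i * (j - int y)"
      using cong(2) by (intro dvd_add dvd_mult)
    also have "\<dots> = (int ?c1 + j * int ?d1) - (1 + 2 ^ i * int y)" by (simp add: algebra_simps)
    finally show "?W (1 + 2 ^ i * int y)" using W window_cong by blast
  next
    assume W: "?W (1 + 2 ^ i * int y)"
    have "2 * int h dvd (1 + 2 ^ i * int y) - (int ?c1 + int y * int ?d1)"
      using cong(2)[of "int y"] by (simp add: dvd_diff_commute)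
    then have W': "?W (int ?c1 + int y * int ?d1)" using W window_cong by blast
    obtain w where "int ?c2 + int y * int ?d2 - int y = 2 * int h * w"
      using cong(1) by blast
    then have w: "int ?c2 + int y * int ?d2 = int y + 2 * int h * w" by simp
    \<comment> \<open>Here \<open>y < 2 h\<close> and \<open>2 ^ i <= h\<close> enter: the witness
      \<open>j = y\<close> lands at no more than \<open>(1 + (2 h - 1) h) x\<close>, inside the
      allowed \<open>4 h^2 x\<close>.\<close>
    have le: "int ?c1 + int y * int ?d1 \<le> (2 * int h) ^ 2 * int ?c1"
    proof -
      have "?d1 \<le> 2 ^ i * ?c1" using a by (rule upper_le_lower)
      also have "\<dots> \<le> h * ?c1" using i by (simp add: h_def)
      finally have "y * ?d1 \<le> (2 * h - 1) * (h * ?c1)" using y by (intro mult_mono) auto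
      then have "?c1 + y * ?d1 \<le> ?c1 + (2 * h - 1) * (h * ?c1)" by (rule add_left_mono)
      also have "\<dots> = (1 + (2 * h - 1) * h) * ?c1" by (simp only: distrib_right mult_1 mult.assoc)
      also have "\<dots> \<le> (2 * h) ^ 2 * ?c1"
      proof (rule mult_right_mono)
        have "1 + (2 * h - 1) * h \<le> h * h + 2 * h * h" using h by (intro add_mono mult_mono) auto
        then show "1 + (2 * h - 1) * h \<le> (2 * h) ^ 2" by (simp add: power2_eq_square)
      qed simp
      finally have "int (?c1 + y * ?d1) \<le> int ((2 * h) ^ 2 * ?c1)" by (simp only: of_nat_le_iff)
      then show ?thesis by simp
    qed
    show "\<exists>u1 u2. int ?c1 \<le> u1 \<and> u1 \<le> (2 * int h) ^ 2 * int ?c1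
      \<and> (\<exists>w. u2 = int y + 2 * int h * w) \<and> ?W u1
      \<and> (\<exists>j\<ge>0. u1 = int ?c1 + j * int ?d1 \<and> u2 = int ?c2 + j * int ?d2)"
    proof (rule exI[of _ "int ?c1 + int y * int ?d1"], rule exI[of _ "int ?c2 + int y * int ?d2"], intro conjI)
      show "\<exists>v. int ?c2 + int y * int ?d2 = int y + 2 * int h * v" by (rule exI[of _ w], rule w)
      show "int ?c1 \<le> int ?c1 + int y * int ?d1" by simp
      show "?W (int ?c1 + int y * int ?d1)" by (rule W')
      show "\<exists>j\<ge>0. int ?c1 + int y * int ?d1 = int ?c1 + j * int ?d1
          \<and> int ?c2 + int y * int ?d2 = int ?c2 + j * int ?d2"
        by (rule exI[of _ "int y"]) simp
    qed (rule le)
  qed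
  also have "\<dots> \<longleftrightarrow> odd ((1 + 2 ^ i * y) div h)"
    using window_iff_odd[OF h, of "1 + 2 ^ i * y"] by simp
  finally show ?thesis .
qed

text \<open>Multiplication by \<open>2 ^ i\<close> moves digit \<open>d - i\<close> to place
  \<open>d\<close>. The added 1 fills the empty lowest place of an even number, so nothing carries,
  and \<open>d > 0\<close> keeps it out of the quotient.\<close>

lemma odd_shift_iff:
  assumes "i < d" "even y"
  shows "odd ((1 + 2 ^ i * y) div 2 ^ d) \<longleftrightarrow> d - i \<in> set_decode y"
proof -
  have "(1 + 2 ^ i * y) div 2 ^ d = 2 ^ i * y div 2 ^ d"
  proof -
    obtain z where z: "y = 2 * z" using assms by blast
    have d: "(2::nat) ^ d = 2 * 2 ^ (d - 1)" using assms by (cases d) auto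
    have "(1 + 2 * (2 ^ i * z)) div (2 * 2 ^ (d - 1)) = (2 * (2 ^ i * z)) div (2 * 2 ^ (d - 1))"
      unfolding div_mult2_eq by simp
    then show ?thesis unfolding d z by (simp add: algebra_simps)
  qed
  also have "\<dots> = 2 ^ i * y div (2 ^ i * 2 ^ (d - i))"
    using assms by (simp add: power_add[symmetric])
  also have "\<dots> = y div 2 ^ (d - i)" by simp
  finally show ?thesis by (simp add: set_decode_def)
qed

lemma fiber_iff: "[x] \<in> fiber [0] [1] F [y] \<longleftrightarrow> holds (assignment [0, 1] [x, y]) F"
  by (simp add: fiber_def)

lemma VC_formula_ge: "enat d \<le> VC_formula [0] [1] (quantified (formula d))"
proof -
  define a :: nat where "a = (2 * 2 ^ d) ^ 2"
  define A where "A = (\<lambda>i. [int (lower a 1 1 i)]) ` {..<d}"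
  have "strict_mono (lower a 1 1)"
    by (rule strict_mono_Suc_iff[THEN iffD2]) (simp add: a_def upper_pos)
  then have inj: "inj (lower a 1 1)" by (rule strict_mono_imp_inj_on)
  then have card: "card A = d" unfolding A_def
    by (subst card_image) (auto simp: inj_on_def)
  let ?S = "\<lambda>y. fiber [0] [1] (quantified (formula d)) [int y]"
  have sub: "\<exists>y. B = ?S y \<inter> A" if "B \<subseteq> A" for B
  proof
    \<comment> \<open>The parameter carries digit \<open>d - i\<close> exactly when object
      \<open>i\<close> is wanted. These positions lie in \<open>{1..d}\<close>, so \<open>y\<close>
      is even and below \<open>2 * 2 ^ d\<close>, as \<open>odd_shift_iff\<close> and
      \<open>holds_formula\<close> require.\<close>
    define K where "K = {d - i |i. i < d \<and> [int (lower a 1 1 i)] \<in> B}"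
    define y where "y = set_encode K"
    have fin: "finite K" and K: "K \<subseteq> {1..d}" by (auto simp: K_def)
    have dec: "set_decode y = K" using fin by (simp add: y_def)
    have y_le: "y < 2 * 2 ^ d"
    proof -
      have "y \<le> (\<Sum>k\<in>{..d}. 2 ^ k)" unfolding y_def set_encode_def using fin K by (intro sum_mono2) auto
      also have "\<dots> = 2 ^ Suc d - 1" using mask_eq_sum_exp_nat[of "Suc d"] by (simp add: atMost_def less_Suc_eq_le)
      also have "\<dots> < 2 ^ Suc d" by simp
      finally show ?thesis by simp
    qed
    have "even y" using dec K set_decode_0[of y] by auto
    then have "[int (lower a 1 1 i)] \<in> ?S y \<longleftrightarrow> [int (lower a 1 1 i)] \<in> B" if "i < d" for i
    proof -
      have "[int (lower a 1 1 i)] \<in> ?S y \<longleftrightarrow> odd ((1 + 2 ^ i * y) div 2 ^ d)"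
        unfolding fiber_iff a_def
        by (rule holds_formula) (use that y_le in \<open>simp_all add: assignment_def\<close>)
      also have "\<dots> \<longleftrightarrow> d - i \<in> K" using odd_shift_iff[OF that \<open>even y\<close>] dec by simp
      also have "\<dots> \<longleftrightarrow> [int (lower a 1 1 i)] \<in> B"
      proof -
        have "i' = i" if "d - i = d - i'" "i' < d" for i' using that \<open>i < d\<close> by linarith
        then show ?thesis using that by (auto simp: K_def)
      qed
      finally show ?thesis .
    qed
    then show "B = ?S y \<inter> A" using that by (auto simp: A_def)
  qed
  have "shatters {fiber [0] [1] (quantified (formula d)) b |b. length b = length [1::nat]} A"
    unfolding shatters_def
  proof (intro allI impI)
    fix B assume "B \<subseteq> A"
    then obtain y where "B = ?S y \<inter> A" using sub by blast
    then show "\<exists>S\<in>{fiber [0] [1] (quantified (formula d)) b |b. length b = length [1::nat]}. B = S \<inter> A"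
      by (intro bexI[of _ "?S y"]) auto
  qed
  then show ?thesis
    unfolding VC_formula_def using card by (intro VC_ge[of A]) (auto simp: A_def)
qed

text \<open>It serves both the length of the formula and the cost of computing it. The exponent
  comes from \<open>3 * d * (d + 1) <= 6 * d ^ 2\<close>; 7 instead of 6 makes the inequality
  strict.\<close>

lemma regs_bound:
  fixes d :: nat
  defines "a \<equiv> (2 * 2 ^ d) ^ 2"
  assumes "i \<le> d" "0 < d" and v: "v \<in> {2 ^ d, 2 * 2 ^ d, a, lower a 1 1 i, lower a 0 1 i, upper a 1 1 i, upper a 0 1 i}"
  shows "v < 2 ^ (7 * d ^ 2)"
proof -
  have d: "d \<le> d * d" "1 \<le> d * d" using assms by (simp_all add: Suc_le_eq)
  have 1: "upper a 1 1 i \<le> (2 * 2 ^ d) ^ (3 * i)"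
    using assms by (intro upper_bound) (auto simp: self_le_power)
  have "(2 * 2 ^ d) ^ (3 * i) \<le> (2 * 2 ^ d :: nat) ^ (3 * d)"
    using assms by (intro power_increasing) auto
  also have "\<dots> = 2 ^ (3 * d * (d + 1))"
    by (metis mult.commute power_Suc power_mult Suc_eq_plus1)
  also have "\<dots> \<le> 2 ^ (6 * d ^ 2)"
    using d unfolding power2_eq_square by (intro power_increasing) (simp_all add: algebra_simps)
  finally have u: "upper a 1 1 i \<le> 2 ^ (6 * d ^ 2)" using 1 by linarith
  have "lower a 0 1 i \<le> lower a 1 1 i" "upper a 0 1 i \<le> upper a 1 1 i" "lower a 1 1 i \<le> upper a 1 1 i"
    by (intro lower_upper_mono lower_le_upper; simp)+
  moreover have "a \<le> 2 ^ (6 * d ^ 2)"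
  proof -
    have "a = 2 ^ ((d + 1) * 2)" by (simp add: a_def power_mult[symmetric] power_Suc[symmetric] del: power_Suc)
    also have "\<dots> \<le> 2 ^ (6 * d ^ 2)"
    proof (rule power_increasing)
      have "(d + 1) * 2 \<le> 6 * e" if "d \<le> e" "1 \<le> e" for e using that by simp
      from this[OF d] show "(d + 1) * 2 \<le> 6 * d ^ 2" by (simp add: power2_eq_square)
    qed simp
    finally show ?thesis .
  qed
  moreover have "2 * 2 ^ d \<le> a" by (simp add: a_def power2_eq_square)
  moreover have "d \<le> 6 * d ^ 2"
  proof -
    have "d \<le> 6 * e" if "d \<le> e" for e using that by simp
    from this[OF d(1)] show ?thesis by (simp add: power2_eq_square)
  qed
  ultimately have "v \<le> 2 ^ (6 * d ^ 2)" using u v by auto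
  also have "\<dots> < 2 ^ (7 * d ^ 2)"
    using assms by (intro power_strict_increasing) auto
  finally show ?thesis .
qed

lemma pa_length_formula:
  assumes "0 < d"
  shows "pa_length (quantified (formula d)) \<le> 1700 * d ^ 2"
proof -
  have d: "1 \<le> d ^ 2" using assms by simp
  have one: "1 < (2::nat) ^ (7 * d ^ 2)" using assms by (intro one_less_power) auto
  have "regs (2 ^ d) (lower ((2 * 2 ^ d) ^ 2) 1 1 d) (lower ((2 * 2 ^ d) ^ 2) 0 1 d) r < 2 ^ (7 * d ^ 2)" for r
    using regs_bound[OF order_refl assms] one d
    by (auto simp: regs_def)
  then have "pa_length (quantified (formula d)) \<le> 1000 + 100 * (7 * d ^ 2)"
    unfolding formula_def by (intro length_encode_template) (simp add: floorlog_le_iff)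
  then show ?thesis using d by linarith
qed

section \<open>Time-bounded deterministic programs\<close>

text \<open>A Hoare triple for total correctness with a time budget; the empty flip sequence
  restricts it to coin-free runs.\<close>

definition triple :: "(store \<Rightarrow> bool) \<Rightarrow> prog \<Rightarrow> nat \<Rightarrow> (store \<Rightarrow> bool) \<Rightarrow> bool" where
  "triple P p t Q \<longleftrightarrow> (\<forall>s. P s \<longrightarrow> (\<exists>t' s'. t' \<le> t \<and> exec p s [] t' s' \<and> Q s'))"

lemma triple_Seq:
  assumes "triple P p t Q" "triple Q q t' R"
  shows "triple P (Seq p q) (t + t') R"
  unfolding triple_def
proof (intro allI impI)
  fix s assume "P s"
  then obtain t1 s1 where 1: "t1 \<le> t" "exec p s [] t1 s1" "Q s1" using assms(1) unfolding triple_def by blast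
  then obtain t2 s2 where 2: "t2 \<le> t'" "exec q s1 [] t2 s2" "R s2" using assms(2) unfolding triple_def by blast
  then show "\<exists>ta s'. ta \<le> t + t' \<and> exec (Seq p q) s [] ta s' \<and> R s'"
    using exec.Seq[OF 1(2) 2(2)] 1 by (intro exI[of _ "t1 + t2"] exI[of _ s2]) auto
qed

lemma triple_mono:
  assumes "triple P p t Q" "\<And>s. P' s \<Longrightarrow> P s" "t \<le> t'" "\<And>s. Q s \<Longrightarrow> Q' s"
  shows "triple P' p t' Q'"
  using assms unfolding triple_def by (meson order.trans)

text \<open>The number of rounds is known beforehand, so the invariant is indexed by the round and
  the induction runs on the rounds left. Each costs a test and a body, and one failing test ends the
  loop.\<close>

lemma triple_Loop:
  assumes body: "\<And>k. k < n \<Longrightarrow> triple (I k) p t (I (Suc k))"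
    and test: "\<And>k s. k \<le> n \<Longrightarrow> I k s \<Longrightarrow> acost e s \<le> t0 \<and> (aval e s = 0 \<longleftrightarrow> k = n)"
  shows "triple (I 0) (Loop e p) (n * (1 + t0 + t) + 1 + t0) (I n)"
proof -
  have "triple (I k) (Loop e p) ((n - k) * (1 + t0 + t) + 1 + t0) (I n)" if "k \<le> n" for k
    using that
  proof (induction "n - k" arbitrary: k)
    case 0
    then have k: "k = n" by simp
    show ?case unfolding triple_def
    proof (intro allI impI)
      fix s assume "I k s"
      then have "aval e s = 0" "acost e s \<le> t0" using test[of k s] k by auto
      then show "\<exists>t' s'. t' \<le> (n - k) * (1 + t0 + t) + 1 + t0 \<and> exec (Loop e p) s [] t' s' \<and> I n s'"
        using exec.LoopFalse[of e s p] \<open>I k s\<close> k by (intro exI[of _ "1 + acost e s"] exI[of _ s]) auto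
    qed
  next
    case (Suc m)
    have k: "k < n" using Suc by simp
    have m: "n - k = Suc (n - Suc k)" using k by simp
    have IH: "triple (I (Suc k)) (Loop e p) ((n - Suc k) * (1 + t0 + t) + 1 + t0) (I n)"
      using Suc by (intro Suc) auto
    show ?case unfolding triple_def
    proof (intro allI impI)
      fix s assume s: "I k s"
      obtain t1 s1 where 1: "t1 \<le> t" "exec p s [] t1 s1" "I (Suc k) s1"
        using body[OF k] s unfolding triple_def by blast
      obtain t2 s2 where 2: "t2 \<le> (n - Suc k) * (1 + t0 + t) + 1 + t0" "exec (Loop e p) s1 [] t2 s2" "I n s2"
        using IH 1(3) unfolding triple_def by blast
      have "aval e s \<noteq> 0" "acost e s \<le> t0" using test[of k s] s k by auto
      then show "\<exists>t' s'. t' \<le> (n - k) * (1 + t0 + t) + 1 + t0 \<and> exec (Loop e p) s [] t' s' \<and> I n s'"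
        using exec.LoopTrue[OF _ 1(2) 2(2)] 1(1) 2(1,3) unfolding m
        by (intro exI[of _ "1 + acost e s + t1 + t2"] exI[of _ s2]) auto
    qed
  qed
  from this[of 0] show ?thesis by simp
qed

section \<open>Cost of expressions and of straight-line code\<close>

primrec value_bits :: "nat \<Rightarrow> arith \<Rightarrow> nat" where
  "value_bits b (Const n) = floorlog 2 n"
| "value_bits b (Reg r) = b"
| "value_bits b (Plus e f) = value_bits b e + value_bits b f + 1"
| "value_bits b (Minus e f) = value_bits b e"
| "value_bits b (Times e f) = value_bits b e + value_bits b f"
| "value_bits b (Div e f) = value_bits b e"

primrec cost_bound :: "nat \<Rightarrow> arith \<Rightarrow> nat" where
  "cost_bound b (Const n) = 1 + floorlog 2 n"
| "cost_bound b (Reg r) = 1 + b"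
| "cost_bound b (Plus e f) = cost_bound b e + cost_bound b f + value_bits b e + value_bits b f + 2"
| "cost_bound b (Minus e f) = cost_bound b e + cost_bound b f + value_bits b e + value_bits b f + 2"
| "cost_bound b (Times e f) = cost_bound b e + cost_bound b f + value_bits b e + value_bits b f + 2"
| "cost_bound b (Div e f) = cost_bound b e + cost_bound b f + value_bits b e + value_bits b f + 2"

primrec reads :: "arith \<Rightarrow> nat set" where
  "reads (Const n) = {}"
| "reads (Reg r) = {r}"
| "reads (Plus e f) = reads e \<union> reads f"
| "reads (Minus e f) = reads e \<union> reads f"
| "reads (Times e f) = reads e \<union> reads f"
| "reads (Div e f) = reads e \<union> reads f"

lemma aval_bound:
  "\<forall>r\<in>reads e. s r < 2 ^ b \<Longrightarrow> aval e s < 2 ^ value_bits b e"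
proof (induction e)
  case (Const n)
  show ?case using floorlog_bounds[of n 2] by (cases "n = 0") auto
next
  case (Plus e f)
  let ?p = "2 ^ value_bits b e :: nat" and ?q = "2 ^ value_bits b f :: nat"
  have "aval e s < ?p" "aval f s < ?q" using Plus by simp_all
  moreover have "?p * 1 \<le> ?p * ?q" "1 * ?q \<le> ?p * ?q" by (intro mult_mono; simp)+
  ultimately have "aval e s + aval f s < 2 * (?p * ?q)" by linarith
  then show ?case by (simp add: power_add)
next
  case (Minus e f)
  then have "aval e s < 2 ^ value_bits b e" by simp
  then show ?case by simp
next
  case (Times e f)
  then have "aval e s * aval f s < 2 ^ value_bits b e * 2 ^ value_bits b f"
    by (intro mult_strict_mono) auto
  then show ?case by (simp add: power_add)
next
  case (Div e f)
  then have "aval e s < 2 ^ value_bits b e" by simp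
  then show ?case by (simp add: order.strict_trans1[OF div_le_dividend])
qed simp

lemma floorlog_aval_bound:
  "\<forall>r\<in>reads e. s r < 2 ^ b \<Longrightarrow> floorlog 2 (aval e s) \<le> value_bits b e"
  using aval_bound by (simp add: floorlog_le_iff)

lemma acost_bound:
  "\<forall>r\<in>reads e. s r < 2 ^ b \<Longrightarrow> acost e s \<le> cost_bound b e"
proof (induction e)
  case (Reg r)
  then show ?case by (simp add: floorlog_le_iff)
next
  case (Plus e f)
  then show ?case using floorlog_aval_bound[of e s b] floorlog_aval_bound[of f s b] by simp
next
  case (Minus e f)
  then show ?case using floorlog_aval_bound[of e s b] floorlog_aval_bound[of f s b] by simp
next
  case (Times e f)
  then show ?case using floorlog_aval_bound[of e s b] floorlog_aval_bound[of f s b] by simp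
next
  case (Div e f)
  then show ?case using floorlog_aval_bound[of e s b] floorlog_aval_bound[of f s b] by simp
qed simp

primrec assigns :: "(nat \<times> arith) list \<Rightarrow> prog" where
  "assigns [] = Skip"
| "assigns (x # l) = Seq (Assign (fst x) (snd x)) (assigns l)"

primrec after :: "(nat \<times> arith) list \<Rightarrow> store \<Rightarrow> store" where
  "after [] s = s"
| "after (x # l) s = after l (s(fst x := aval (snd x) s))"

primrec assigns_time :: "nat \<Rightarrow> (nat \<times> arith) list \<Rightarrow> nat" where
  "assigns_time b [] = 1"
| "assigns_time b (x # l) = 1 + cost_bound b (snd x) + assigns_time b l"

text \<open>A register has to be small only at the moment it is read, so a result may outgrow
  \<open>2 ^ b\<close> if nothing later in the list reads it.\<close>

primrec reads_bounded :: "nat \<Rightarrow> (nat \<times> arith) list \<Rightarrow> store \<Rightarrow> bool" where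
  "reads_bounded b [] s \<longleftrightarrow> True"
| "reads_bounded b (x # l) s \<longleftrightarrow>
     (\<forall>r\<in>reads (snd x). s r < 2 ^ b) \<and> reads_bounded b l (s(fst x := aval (snd x) s))"

lemma triple_assigns:
  assumes "\<And>s. P s \<Longrightarrow> reads_bounded b l s \<and> Q (after l s)" "assigns_time b l \<le> t"
  shows "triple P (assigns l) t Q"
proof -
  have "\<exists>t'\<le>assigns_time b l. exec (assigns l) s [] t' (after l s)" if "reads_bounded b l s" for s
    using that
  proof (induction l arbitrary: s)
    case (Cons x l)
    let ?s = "s(fst x := aval (snd x) s)"
    obtain t' where t': "t' \<le> assigns_time b l" "exec (assigns l) ?s [] t' (after l ?s)"
      using Cons by auto
    have "acost (snd x) s \<le> cost_bound b (snd x)" using Cons.prems by (intro acost_bound) simp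
    then show ?case using exec.Seq[OF exec.Assign t'(2)] t'(1)
      by (intro exI[of _ "1 + acost (snd x) s + t'"]) auto
  qed (auto intro: exI[of _ 1] exec.Skip)
  then show ?thesis using assms unfolding triple_def by (meson order.trans)
qed

section \<open>Writing encodings into the output register\<close>

lemma floorlog_2_numerals: "floorlog 2 (Suc 0) = 1" "floorlog 2 2 = 2" "floorlog 2 4 = 3"
  by (rule antisym, simp add: floorlog_le_iff, rule floorlog_geI, simp, simp)+

text \<open>
  Register 0 accumulates the output and register 1 the weight of the next digit; register 2 is scratch.
\<close>

definition written :: "bool list \<Rightarrow> store \<Rightarrow> bool" where
  "written w s \<longleftrightarrow> s 0 = horner_sum of_bool 2 w \<and> s 1 = 2 ^ length w"

text \<open>A binary digit \<open>x\<close> is appended as the pair \<open>[True, x]\<close>, worth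
  \<open>1 + 2 x\<close> at the current weight, which then grows by 4; \<open>x\<close> is register
  2 minus twice its half. The closing \<open>False\<close> changes only the weight.\<close>

primrec emit :: "item \<Rightarrow> prog" where
  "emit (Bits bs) = assigns
     [(0, Plus (Reg 0) (Times (Reg 1) (Const (horner_sum of_bool 2 bs)))),
      (1, Times (Reg 1) (Const (2 ^ length bs)))]"
| "emit (Num r) = Seq (assigns [(2, Reg r)])
     (Seq (Loop (Reg 2) (assigns
        [(0, Plus (Reg 0) (Times (Reg 1)
           (Plus (Const 1) (Times (Const 2) (Minus (Reg 2) (Times (Const 2) (Div (Reg 2) (Const 2)))))))),
         (1, Times (Const 4) (Reg 1)),
         (2, Div (Reg 2) (Const 2))]))
     (assigns [(1, Times (Const 2) (Reg 1))]))"

lemma horner_sum_less: "(horner_sum of_bool 2 bs :: nat) < 2 ^ length bs"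
  by (induction bs) auto

lemma written_bound:
  assumes "written w s" "length w < b"
  shows "s 0 < 2 ^ b" "s (Suc 0) < 2 ^ b"
proof -
  have "s 0 < 2 ^ length w" using assms horner_sum_less by (simp add: written_def)
  also have "\<dots> < 2 ^ b" using assms by simp
  finally show "s 0 < 2 ^ b" .
  show "s (Suc 0) < 2 ^ b" using assms by (simp add: written_def)
qed

lemma written_append:
  assumes "written w s"
  shows "written (w @ v) s' \<longleftrightarrow> s' 0 = s 0 + s 1 * horner_sum of_bool 2 v \<and> s' 1 = s 1 * 2 ^ length v"
  using assms by (simp add: written_def horner_sum_append power_add)

text \<open>Quadratic, because a number has fewer than \<open>b\<close> digits and each is appended
  by arithmetic on numbers of \<open>O(b)\<close> bits.\<close>

definition emit_time :: "nat \<Rightarrow> nat" where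
  "emit_time b = 200 * (b + 1) * (b + 1)"

lemma triple_emit:
  assumes "length (w @ item_bits s0 it) < b" "\<And>r. it = Num r \<Longrightarrow> 3 \<le> r"
  shows "triple (\<lambda>s. written w s \<and> (\<forall>r\<ge>3. s r = s0 r)) (emit it) (emit_time b)
    (\<lambda>s. written (w @ item_bits s0 it) s \<and> (\<forall>r\<ge>3. s r = s0 r))"
proof (cases it)
  case (Bits bs)
  have "floorlog 2 (horner_sum of_bool 2 bs :: nat) \<le> b"
    using horner_sum_less[of bs] assms(1) Bits by (intro floorlog_leI) (auto intro: order.strict_trans2)
  moreover have "floorlog 2 (2 ^ length bs) \<le> b"
    using assms(1) Bits by (simp add: floorlog_le_iff)
  ultimately have time: "assigns_time b
     [(0, Plus (Reg 0) (Times (Reg 1) (Const (horner_sum of_bool 2 bs)))),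
      (1, Times (Reg 1) (Const (2 ^ length bs)))] \<le> emit_time b"
    by (simp add: emit_time_def algebra_simps)
  show ?thesis unfolding Bits emit.simps item_bits.simps
  proof (rule triple_assigns[OF _ time])
    fix s assume s: "written w s \<and> (\<forall>r\<ge>3. s r = s0 r)"
    moreover have "length w < b" using assms(1) by simp
    ultimately show "reads_bounded b
     [(0, Plus (Reg 0) (Times (Reg 1) (Const (horner_sum of_bool 2 bs)))),
      (1, Times (Reg 1) (Const (2 ^ length bs)))] s \<and>
      written (w @ bs) (after
     [(0, Plus (Reg 0) (Times (Reg 1) (Const (horner_sum of_bool 2 bs)))),
      (1, Times (Reg 1) (Const (2 ^ length bs)))] s) \<and>
      (\<forall>r\<ge>3. after
     [(0, Plus (Reg 0) (Times (Reg 1) (Const (horner_sum of_bool 2 bs)))),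
      (1, Times (Reg 1) (Const (2 ^ length bs)))] s r = s0 r)"
      using written_bound[of w s b] by (simp add: written_append[of w s])
  qed
next
  case (Num r)
  define n where "n = s0 r"
  define N where "N = floorlog 2 n"
  have r: "3 \<le> r" using assms(2) Num by simp
  define digits where "digits = (\<lambda>k. concat (map (\<lambda>j. [True, bit n j]) [0..<k]))"
  have digits_Suc: "digits (Suc k) = digits k @ [True, bit n k]" for k by (simp add: digits_def)
  have enc: "item_bits s0 it = digits N @ [False]" by (simp add: Num encode_nat_def digits_def n_def N_def)
  have len: "length (digits k) = 2 * k" for k by (induction k) (auto simp: digits_Suc digits_def)
  have b: "length w + 2 * N + 1 < b" using assms(1) by (simp add: enc len)
  have n: "n < 2 ^ N" using floorlog_bounds[of n 2] by (cases "n = 0") (auto simp: N_def)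
  also have "\<dots> \<le> 2 ^ b" using b by (intro power_increasing) auto
  finally have nb: "n < 2 ^ b" .
  define I where "I = (\<lambda>k s. s 2 = n div 2 ^ k \<and> written (w @ digits k) s \<and> (\<forall>r\<ge>3. s r = s0 r))"
  have nk: "n div 2 ^ k < 2 ^ b" for k using nb by (rule order.strict_trans1[OF div_le_dividend])
  have 1: "triple (\<lambda>s. written w s \<and> (\<forall>r\<ge>3. s r = s0 r)) (assigns [(2, Reg r)]) (b + 3) (I 0)"
    by (rule triple_assigns[of _ b]) (use nb r in \<open>auto simp: I_def written_def n_def digits_def\<close>)
  have 2: "triple (I k) (assigns
        [(0, Plus (Reg 0) (Times (Reg 1)
           (Plus (Const 1) (Times (Const 2) (Minus (Reg 2) (Times (Const 2) (Div (Reg 2) (Const 2)))))))),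
         (1, Times (Const 4) (Reg 1)),
         (2, Div (Reg 2) (Const 2))]) (100 * b + 100) (I (Suc k))" if "k < N" for k
  proof (rule triple_assigns[of _ b])
    fix s assume s: "I k s"
    then have w: "written (w @ digits k) s" by (simp add: I_def)
    have half: "n div (2 * 2 ^ k) = n div 2 ^ k div 2"
      by (metis div_mult2_eq mult.commute)
    have "n div 2 ^ k - 2 * (n div 2 ^ k div 2) = of_bool (bit n k)"
      by (simp add: minus_mult_div_eq_mod mod_2_eq_odd bit_iff_odd)
    then show "reads_bounded b [(0, Plus (Reg 0) (Times (Reg 1)
           (Plus (Const 1) (Times (Const 2) (Minus (Reg 2) (Times (Const 2) (Div (Reg 2) (Const 2)))))))),
         (1, Times (Const 4) (Reg 1)),
         (2, Div (Reg 2) (Const 2))] s \<and> I (Suc k) (after [(0, Plus (Reg 0) (Times (Reg 1)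
           (Plus (Const 1) (Times (Const 2) (Minus (Reg 2) (Times (Const 2) (Div (Reg 2) (Const 2)))))))),
         (1, Times (Const 4) (Reg 1)),
         (2, Div (Reg 2) (Const 2))] s)"
      using s nk[of k] written_bound[OF w, of b] b that
      by (auto simp: I_def digits_Suc written_append[OF w] written_append[OF w, unfolded append_assoc] len
        half)
  qed (simp add: floorlog_2_numerals)
  \<comment> \<open>\<open>n >= 2 ^ (N - 1)\<close> keeps register 2 nonzero until all
    \<open>N\<close> digits are out, so there are exactly \<open>N\<close> rounds.\<close>
  have 3: "acost (Reg 2) s \<le> b + 1 \<and> (aval (Reg 2) s = 0 \<longleftrightarrow> k = N)" if "k \<le> N" "I k s" for k s
  proof -
    have "n div 2 ^ k \<noteq> 0" if "k < N"
    proof -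
      have "n > 0" using that by (cases "n = 0") (auto simp: N_def floorlog_def)
      then have "2 ^ (N - 1) \<le> n" using floorlog_bounds[of n 2] by (simp add: N_def)
      moreover have "2 ^ k \<le> (2 ^ (N - 1) :: nat)" using that by (intro power_increasing) auto
      ultimately have "2 ^ k \<le> n" by linarith
      then show ?thesis by (simp add: div_eq_0_iff not_less)
    qed
    then have "n div 2 ^ k = 0 \<longleftrightarrow> k = N" using that(1) n by (cases "k = N") auto
    then show ?thesis using that(2) nk[of k] by (auto simp: I_def floorlog_le_iff)
  qed
  have 4: "triple (I N) (assigns [(1, Times (Const 2) (Reg 1))]) (3 * b + 20)
     (\<lambda>s. written (w @ item_bits s0 it) s \<and> (\<forall>r\<ge>3. s r = s0 r))"
  proof (rule triple_assigns[of _ b])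
    fix s assume s: "I N s"
    then have w: "written (w @ digits N) s" by (simp add: I_def)
    then show "reads_bounded b [(1, Times (Const 2) (Reg 1))] s \<and>
      written (w @ item_bits s0 it) (after [(1, Times (Const 2) (Reg 1))] s) \<and>
      (\<forall>r\<ge>3. after [(1, Times (Const 2) (Reg 1))] s r = s0 r)"
      using s written_bound[OF w, of b] b
      by (auto simp: I_def enc len written_append[OF w, unfolded append_assoc])
  qed (simp add: floorlog_2_numerals)
  have loop: "triple (I 0) (Loop (Reg 2) (assigns
        [(0, Plus (Reg 0) (Times (Reg 1)
           (Plus (Const 1) (Times (Const 2) (Minus (Reg 2) (Times (Const 2) (Div (Reg 2) (Const 2)))))))),
         (1, Times (Const 4) (Reg 1)),
         (2, Div (Reg 2) (Const 2))])) (N * (1 + (b + 1) + (100 * b + 100)) + 1 + (b + 1)) (I N)"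
    by (rule triple_Loop; fact 2 3)
  have "N * (1 + (b + 1) + (100 * b + 100)) \<le> b * (101 * b + 102)"
    using b by (intro mult_mono) auto
  then have time: "(b + 3) + (N * (1 + (b + 1) + (100 * b + 100)) + 1 + (b + 1) + (3 * b + 20)) \<le> emit_time b"
    by (simp add: emit_time_def algebra_simps)
  show ?thesis
    unfolding Num emit.simps
    by (rule triple_mono[OF triple_Seq[OF 1 triple_Seq[OF loop 4[unfolded Num]]] _ time])
qed

primrec emits :: "item list \<Rightarrow> prog" where
  "emits [] = Skip"
| "emits (it # its) = Seq (emit it) (emits its)"

lemma triple_emits:
  assumes "length (w @ concat (map (item_bits s0) its)) < b" "\<And>r. Num r \<in> set its \<Longrightarrow> 3 \<le> r"
  shows "triple (\<lambda>s. written w s \<and> (\<forall>r\<ge>3. s r = s0 r)) (emits its) (length its * emit_time b + 1)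
    (\<lambda>s. written (w @ concat (map (item_bits s0) its)) s \<and> (\<forall>r\<ge>3. s r = s0 r))"
  using assms
proof (induction its arbitrary: w)
  case Nil
  then show ?case by (auto simp: triple_def intro!: exI[of _ 1] exec.Skip)
next
  case (Cons it its)
  have "triple (\<lambda>s. written w s \<and> (\<forall>r\<ge>3. s r = s0 r)) (emit it) (emit_time b)
    (\<lambda>s. written (w @ item_bits s0 it) s \<and> (\<forall>r\<ge>3. s r = s0 r))"
    using Cons.prems by (intro triple_emit) auto
  from triple_Seq[OF this Cons.IH] Cons.prems show ?case
    by (simp add: add.assoc)
qed

section \<open>Computing the formula\<close>

lemma formula_shape:
  "quantifier_free (formula d)" "vars (formula d) \<subseteq> {..<10}" "quantified (formula d) \<in> Short_PA 10 18"
  unfolding formula_def by (rule instantiate_template_shape)+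

definition doubling :: "(nat \<times> arith) list" where
  "doubling = [(3, Times (Const 2) (Reg 3)), (2, Minus (Reg 2) (Const 1))]"

text \<open>Registers 6 to 9 hold the coordinates of \<open>C\<close> and then of \<open>D\<close>.
  The order matters: 8 and 9 are computed from the new 6 and 7, as in
  \<open>upper_Suc\<close>.\<close>

definition convergent_step :: "(nat \<times> arith) list" where
  "convergent_step =
     [(6, Plus (Reg 6) (Times (Reg 5) (Reg 8))), (7, Plus (Reg 7) (Times (Reg 5) (Reg 9))),
      (8, Plus (Reg 8) (Times (Reg 10) (Reg 6))), (9, Plus (Reg 9) (Times (Reg 10) (Reg 7))),
      (10, Times (Const 2) (Reg 10)), (0, Minus (Reg 0) (Const 1))]"

text \<open>Register 7, the second coordinate of the first \<open>C\<close>, keeps its initial value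
  0, and so does register 12, the constant 0 of the template.\<close>

definition convergent_start :: "(nat \<times> arith) list" where
  "convergent_start =
     [(4, Times (Const 2) (Reg 3)), (5, Times (Reg 4) (Reg 4)),
      (6, Const 1), (8, Const 1), (9, Const 1), (10, Const 1), (11, Const 1)]"

text \<open>The second loop counts register 0 down to zero, which leaves it as an empty accumulator
  for the output. The last assignment adds the weight of the next digit, that is, the leading 1
  demanded by \<open>outputs\<close>.\<close>

definition formula_prog :: prog where
  "formula_prog =
     Seq (assigns [(2, Reg 0), (3, Const 1)])
    (Seq (Loop (Reg 2) (assigns doubling))
    (Seq (assigns convergent_start)
    (Seq (Loop (Reg 0) (assigns convergent_step))
    (Seq (assigns [(1, Const 1)])
    (Seq (emits (items template))
         (assigns [(0, Plus (Reg 0) (Reg 1))]))))))"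

lemma triple_doubling_loop:
  assumes "d < 2 ^ b" "2 ^ d < (2 ^ b :: nat)"
  shows "triple (\<lambda>s. s 0 = d \<and> s 2 = d \<and> s 3 = 1 \<and> (\<forall>r>3. s r = 0)) (Loop (Reg 2) (assigns doubling))
    (d * (1 + (b + 1) + (100 * b + 100)) + 1 + (b + 1))
    (\<lambda>s. s 0 = d \<and> s 3 = 2 ^ d \<and> (\<forall>r>3. s r = 0))"
proof -
  define I where "I = (\<lambda>k s. s 0 = d \<and> s 2 = d - k \<and> s 3 = (2 ^ k :: nat) \<and> (\<forall>r>3::nat. s r = 0))"
  have "triple (I 0) (Loop (Reg 2) (assigns doubling))
    (d * (1 + (b + 1) + (100 * b + 100)) + 1 + (b + 1)) (I d)"
  proof (rule triple_Loop)
    fix k assume k: "k < d"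
    have "2 ^ k < (2 ^ d :: nat)" using k by simp
    then have "2 ^ k < (2 ^ b :: nat)" using assms by linarith
    moreover have "d - k < 2 ^ b" using assms by linarith
    ultimately show "triple (I k) (assigns doubling) (100 * b + 100) (I (Suc k))"
      by (intro triple_assigns[of _ b]) (auto simp: I_def doubling_def floorlog_2_numerals)
  next
    fix k s assume "k \<le> d" "I k s"
    moreover have "d - k < 2 ^ b" using assms by linarith
    ultimately show "acost (Reg 2) s \<le> b + 1 \<and> (aval (Reg 2) s = 0 \<longleftrightarrow> k = d)"
      by (auto simp: I_def floorlog_le_iff)
  qed
  then show ?thesis by (rule triple_mono) (auto simp: I_def)
qed

lemma triple_convergent_loop:
  assumes "d < 2 ^ b" "2 ^ d < (2 ^ b :: nat)" "a < 2 ^ b"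
    and "\<And>i. i \<le> d \<Longrightarrow> lower a 1 1 i < 2 ^ b" "\<And>i. i \<le> d \<Longrightarrow> lower a 0 1 i < 2 ^ b"
    and "\<And>i. i \<le> d \<Longrightarrow> upper a 1 1 i < 2 ^ b" "\<And>i. i \<le> d \<Longrightarrow> upper a 0 1 i < 2 ^ b"
  shows "triple (\<lambda>s. s 0 = d \<and> s 3 = h \<and> s 4 = 2 * h \<and> s 5 = a \<and> s 6 = 1 \<and> s 7 = 0 \<and> s 8 = 1 \<and> s 9 = 1
      \<and> s 10 = 1 \<and> s 11 = 1 \<and> s 12 = 0)
    (Loop (Reg 0) (assigns convergent_step))
    (d * (1 + (b + 1) + (100 * b + 100)) + 1 + (b + 1))
    (\<lambda>s. s 0 = 0 \<and> s 3 = h \<and> s 4 = 2 * h \<and> s 5 = a \<and> s 6 = lower a 1 1 d \<and> s 7 = lower a 0 1 d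
      \<and> s 11 = 1 \<and> s 12 = 0)"
proof -
  define I where "I = (\<lambda>k s. s 0 = d - k \<and> s 3 = h \<and> s 4 = 2 * h \<and> s 5 = a
    \<and> s 6 = lower a 1 1 k \<and> s 7 = lower a 0 1 k \<and> s 8 = upper a 1 1 k \<and> s 9 = upper a 0 1 k
    \<and> s 10 = (2 ^ k :: nat) \<and> s 11 = 1 \<and> s (12::nat) = 0)"
  have "triple (I 0) (Loop (Reg 0) (assigns convergent_step))
    (d * (1 + (b + 1) + (100 * b + 100)) + 1 + (b + 1)) (I d)"
  proof (rule triple_Loop)
    fix k assume k: "k < d"
    have "2 ^ k < (2 ^ d :: nat)" using k by simp
    then have "2 ^ k < (2 ^ b :: nat)" using assms by linarith
    moreover have "d - k < 2 ^ b" using assms by linarith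
    \<comment> \<open>The bounds at \<open>Suc k\<close> are for registers 6 and 7 after their
      update, since the step reads them again.\<close>
    moreover have "lower a 1 1 k < 2 ^ b" "lower a 0 1 k < 2 ^ b" "upper a 1 1 k < 2 ^ b" "upper a 0 1 k < 2 ^ b"
      "lower a 1 1 (Suc k) < 2 ^ b" "lower a 0 1 (Suc k) < 2 ^ b"
      by (intro assms(4-7); use k in simp)+
    ultimately show "triple (I k) (assigns convergent_step) (100 * b + 100) (I (Suc k))"
      using assms(3)
      by (intro triple_assigns[of _ b]) (auto simp: I_def convergent_step_def floorlog_2_numerals)
  next
    fix k s assume "k \<le> d" "I k s"
    moreover have "d - k < 2 ^ b" using assms by linarith
    ultimately show "acost (Reg 0) s \<le> b + 1 \<and> (aval (Reg 0) s = 0 \<longleftrightarrow> k = d)"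
      by (auto simp: I_def floorlog_le_iff)
  qed
  then show ?thesis by (rule triple_mono) (auto simp: I_def)
qed

lemma instantiate_template_cong:
  assumes "\<And>r. r \<in> {3, 4, 5, 6, 7, 11, 12} \<Longrightarrow> s r = s' r"
  shows "instantiate s template = instantiate s' template"
  using assms by (simp add: template_def)

lemma triple_print_template:
  assumes "h > 0" "p > 0" "q > 0" "length (encode (instantiate (regs h q p) template)) + 1 < b"
  shows "triple (\<lambda>s. s 0 = 0 \<and> s 3 = h \<and> s 4 = 2 * h \<and> s 5 = (2 * h) ^ 2 \<and> s 6 = q \<and> s 7 = p \<and> s 11 = 1 \<and> s 12 = 0)
    (Seq (assigns [(1, Const 1)]) (Seq (emits (items template)) (assigns [(0, Plus (Reg 0) (Reg 1))])))
    (4 + (130 * emit_time b + (10 * b + 10)))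
    (\<lambda>s. outputs s (encode (instantiate (regs h q p) template)))"
proof -
  let ?w = "encode (instantiate (regs h q p) template)"
  \<comment> \<open>Fixing the starting store \<open>s1\<close> allows the output to be expressed
    through its registers, which printing leaves unchanged from 3 on.\<close>
  have "triple (\<lambda>s. s = s1) (Seq (assigns [(1, Const 1)]) (Seq (emits (items template)) (assigns [(0, Plus (Reg 0) (Reg 1))])))
    (4 + (130 * emit_time b + (10 * b + 10))) (\<lambda>s. outputs s ?w)"
    if s1: "s1 0 = 0 \<and> s1 3 = h \<and> s1 4 = 2 * h \<and> s1 5 = (2 * h) ^ 2 \<and> s1 6 = q \<and> s1 7 = p \<and> s1 11 = 1 \<and> s1 12 = 0" for s1
  proof -
    have "instantiate s1 template = instantiate (regs h q p) template"
      by (rule instantiate_template_cong) (use s1 in \<open>auto simp: regs_def\<close>)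
    \<comment> \<open>These are the registers that occur with a minus sign, where
      \<open>encode_instantiate\<close> needs nonzero contents.\<close>
    moreover have "0 < s1 3" "0 < s1 4" "0 < s1 5" "0 < s1 6" "0 < s1 7" "0 < s1 11"
      using s1 assms(1-3) by simp_all
    then have "encode (instantiate s1 template) = concat (map (item_bits s1) (items template))"
      by (intro encode_instantiate) (auto simp: template_def)
    ultimately have w: "concat (map (item_bits s1) (items template)) = ?w" by simp
    have 1: "triple (\<lambda>s. s = s1) (assigns [(1, Const 1)]) 4 (\<lambda>s. written [] s \<and> (\<forall>r\<ge>3. s r = s1 r))"
      using s1 by (intro triple_assigns[of _ b]) (auto simp: written_def floorlog_2_numerals)
    have nums: "3 \<le> r" if "Num r \<in> set (items template)" for r
      using that by (auto simp: template_def)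
    have 2: "triple (\<lambda>s. written [] s \<and> (\<forall>r\<ge>3. s r = s1 r)) (emits (items template)) (length (items template) * emit_time b + 1)
       (\<lambda>s. written ?w s \<and> (\<forall>r\<ge>3. s r = s1 r))"
      using triple_emits[of "[]" s1 "items template" b] assms(4) nums by (simp add: w)
    have len: "length (items template) \<le> 129" by (simp add: template_def)
    have "1 \<le> emit_time b" by (simp add: emit_time_def)
    moreover have "length (items template) * emit_time b \<le> 129 * emit_time b"
      using len by (rule mult_right_mono) simp
    ultimately have le: "length (items template) * emit_time b + 1 \<le> 130 * emit_time b" by linarith
    have 2: "triple (\<lambda>s. written [] s \<and> (\<forall>r\<ge>3. s r = s1 r)) (emits (items template)) (130 * emit_time b) (written ?w)"
      by (rule triple_mono[OF 2 _ le]) simp_all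
    have 3: "triple (written ?w) (assigns [(0, Plus (Reg 0) (Reg 1))]) (10 * b + 10) (\<lambda>s. outputs s ?w)"
      using written_bound[of ?w _ b] assms(4)
      by (intro triple_assigns[of _ b]) (auto simp: outputs_def written_def horner_sum_append)
    show ?thesis by (rule triple_Seq[OF 1 triple_Seq[OF 2 3]])
  qed
  then show ?thesis unfolding triple_def by blast
qed

lemma triple_formula_prog:
  assumes "0 < d"
  shows "triple (\<lambda>s. s = initial d) formula_prog (30000 * (2000 * d ^ 2 + 1) ^ 2) (\<lambda>s. outputs s (encode (formula d)))"
proof -
  define h :: nat where "h = 2 ^ d"
  define a where "a = (2 * h) ^ 2"
  \<comment> \<open>Large enough for the register values, of at most \<open>7 * d ^ 2\<close> bits,
    and for the output string of at most \<open>1700 * d ^ 2\<close> bits, which becomes a single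
    number.\<close>
  define b where "b = 2000 * d ^ 2"
  have d2: "d \<le> d ^ 2" "1 \<le> d ^ 2" using assms by (simp_all add: power2_eq_square)
  have bound: "v < 2 ^ b" if "i \<le> d" "v \<in> {2 ^ d, 2 * 2 ^ d, a, lower a 1 1 i, lower a 0 1 i, upper a 1 1 i, upper a 0 1 i}" for v i
  proof -
    have "v < 2 ^ (7 * d ^ 2)" using regs_bound[OF that(1) assms] that(2) by (simp add: a_def h_def)
    also have "\<dots> \<le> 2 ^ b" by (intro power_increasing) (simp_all add: b_def)
    finally show ?thesis .
  qed
  have hb: "2 ^ d < (2 ^ b :: nat)" "2 * h < 2 ^ b" "a < 2 ^ b" using bound[of d] by (simp_all add: h_def)
  have db: "d < 2 ^ b" using hb(1) less_exp[of d] by linarith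
  have 1: "triple (\<lambda>s. s = initial d) (assigns [(2, Reg 0), (3, Const 1)]) (b + 10)
     (\<lambda>s. s 0 = d \<and> s 2 = d \<and> s 3 = 1 \<and> (\<forall>r>3. s r = 0))"
    using db by (intro triple_assigns[of _ b]) (auto simp: initial_def floorlog_2_numerals)
  have 2: "triple (\<lambda>s. s 0 = d \<and> s 3 = 2 ^ d \<and> (\<forall>r>3. s r = 0)) (assigns convergent_start) (100 * b + 100)
      (\<lambda>s. s 0 = d \<and> s 3 = h \<and> s 4 = 2 * h \<and> s 5 = a \<and> s 6 = 1 \<and> s 7 = 0 \<and> s 8 = 1 \<and> s 9 = 1
      \<and> s 10 = 1 \<and> s 11 = 1 \<and> s 12 = 0)"
    using hb by (intro triple_assigns[of _ b])
      (auto simp: convergent_start_def floorlog_2_numerals h_def a_def power2_eq_square)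
  have 3: "triple (\<lambda>s. s 0 = d \<and> s 3 = h \<and> s 4 = 2 * h \<and> s 5 = a \<and> s 6 = 1 \<and> s 7 = 0 \<and> s 8 = 1 \<and> s 9 = 1
      \<and> s 10 = 1 \<and> s 11 = 1 \<and> s 12 = 0)
    (Loop (Reg 0) (assigns convergent_step))
    (d * (1 + (b + 1) + (100 * b + 100)) + 1 + (b + 1))
    (\<lambda>s. s 0 = 0 \<and> s 3 = h \<and> s 4 = 2 * h \<and> s 5 = a \<and> s 6 = lower a 1 1 d \<and> s 7 = lower a 0 1 d
      \<and> s 11 = 1 \<and> s 12 = 0)"
    by (rule triple_convergent_loop) (use db hb bound in blast)+
  have f: "formula d = instantiate (regs h (lower a 1 1 d) (lower a 0 1 d)) template"
    by (simp add: formula_def h_def a_def)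
  have "length (encode (formula d)) \<le> pa_length (quantified (formula d))"
    by (simp add: pa_length_def quantified_eq)
  also have "\<dots> \<le> 1700 * d ^ 2" using assms by (rule pa_length_formula)
  finally have len: "length (encode (formula d)) + 1 < b" using d2 by (simp add: b_def)
  have "a > 0" by (simp add: a_def h_def)
  \<comment> \<open>Here \<open>0 < d\<close> matters: the recursion starts with second coordinate
    0.\<close>
  have "lower a 0 1 d > 0" using \<open>0 < d\<close> \<open>a > 0\<close> by (cases d) (auto simp: upper_pos)
  then have 4: "triple
    (\<lambda>s. s 0 = 0 \<and> s 3 = h \<and> s 4 = 2 * h \<and> s 5 = a \<and> s 6 = lower a 1 1 d \<and> s 7 = lower a 0 1 d
      \<and> s 11 = 1 \<and> s 12 = 0)
    (Seq (assigns [(1, Const 1)]) (Seq (emits (items template)) (assigns [(0, Plus (Reg 0) (Reg 1))])))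
    (4 + (130 * emit_time b + (10 * b + 10)))
    (\<lambda>s. outputs s (encode (formula d)))"
    unfolding f a_def by (intro triple_print_template) (use len in \<open>simp_all add: f a_def h_def lower_pos\<close>)
  have "d * (1 + (b + 1) + (100 * b + 100)) \<le> b * (101 * b + 102)"
    using d2 by (intro mult_mono) (auto simp: b_def)
  \<comment> \<open>Printing dominates: \<open>130 * emit_time b\<close> is
    \<open>26000 * (b + 1) ^ 2\<close>, and the rest fits into the remaining
    \<open>4000 * (b + 1) ^ 2\<close>.\<close>
  then have time: "(b + 10) + ((d * (1 + (b + 1) + (100 * b + 100)) + 1 + (b + 1)) + ((100 * b + 100)
      + ((d * (1 + (b + 1) + (100 * b + 100)) + 1 + (b + 1)) + (4 + (130 * emit_time b + (10 * b + 10))))))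
    \<le> 30000 * (2000 * d ^ 2 + 1) ^ 2"
    unfolding b_def[symmetric] by (simp add: emit_time_def power2_eq_square algebra_simps)
  show ?thesis unfolding formula_prog_def
    by (rule triple_mono[OF triple_Seq[OF 1 triple_Seq[OF triple_doubling_loop[OF db hb(1)] triple_Seq[OF 2 triple_Seq[OF 3 4]]]] _ time])
qed

text \<open>A run without flips uses the empty prefix of every coin sequence, so its answer is
  acceptable with probability 1.\<close>

lemma deterministic_poly_time:
  assumes "\<And>d. 0 < d \<Longrightarrow> triple (\<lambda>s. s = initial d) p (poly P d) (\<lambda>s. outputs s (f d))"
    and "\<And>d. 0 < d \<Longrightarrow> R d (f d)"
  shows "probabilistic_poly_time R"
  unfolding probabilistic_poly_time_def Let_def
proof (intro exI[of _ p] exI[of _ P] allI impI conjI)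
  fix d :: nat assume d: "0 < d"
  let ?coins = "{\<omega> :: bool list. length \<omega> = poly P d}"
  obtain t s where ts: "t \<le> poly P d" "exec p (initial d) [] t s" "outputs s (f d)"
    using assms(1)[OF d] unfolding triple_def by blast
  have run: "exec p (initial d) (take 0 \<omega>) t s" for \<omega> using ts(2) by simp
  show "\<forall>\<omega>\<in>?coins. \<exists>n t s. exec p (initial d) (take n \<omega>) t s \<and> t \<le> poly P d"
    using run ts(1) by blast
  have "{\<omega>. \<exists>n t s w. exec p (initial d) (take n \<omega>) t s \<and> outputs s w \<and> R d w} = UNIV"
    using run ts(3) assms(2)[OF d] by blast
  then show "2 / 3 \<le> measure_pmf.prob (pmf_of_set ?coins)
      {\<omega>. \<exists>n t s w. exec p (initial d) (take n \<omega>) t s \<and> outputs s w \<and> R d w}"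
    by simp
qed

theorem theorem2:
  "\<exists>C :: nat.
     let good = (\<lambda>(d :: nat) (\<Psi> :: pa).
           quantifier_free \<Psi> \<and> vars \<Psi> \<subseteq> {..<10} \<and>
           (let F = foldr Exists [2..<8] (foldr Forall [8..<10] \<Psi>)
            in F \<in> Short_PA 10 18 \<and>
               pa_length F \<le> C * d ^ 2 \<and>
               VC_formula [0] [1] F \<ge> enat d))
     in (\<forall>d>0. \<exists>\<Psi>. good d \<Psi>) \<and>
        probabilistic_poly_time (\<lambda>d w. \<exists>\<Psi>. w = encode \<Psi> \<and> good d \<Psi>)"
proof -
  define good where "good = (\<lambda>(d :: nat) (\<Psi> :: pa). quantifier_free \<Psi> \<and> vars \<Psi> \<subseteq> {..<10} \<and>
    quantified \<Psi> \<in> Short_PA 10 18 \<and> pa_length (quantified \<Psi>) \<le> 1700 * d ^ 2 \<and>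
    VC_formula [0] [1] (quantified \<Psi>) \<ge> enat d)"
  have good: "good d (formula d)" if "0 < d" for d
    unfolding good_def by (intro conjI formula_shape pa_length_formula VC_formula_ge that)
  have "probabilistic_poly_time (\<lambda>d w. \<exists>\<Psi>. w = encode \<Psi> \<and> good d \<Psi>)"
  proof (rule deterministic_poly_time)
    fix d :: nat assume d: "0 < d"
    have "poly (smult 30000 ([:1, 0, 2000:] ^ 2)) d = 30000 * (2000 * d ^ 2 + 1) ^ 2"
      by (simp add: poly_power power2_eq_square algebra_simps)
    then show "triple (\<lambda>s. s = initial d) formula_prog (poly (smult 30000 ([:1, 0, 2000:] ^ 2)) d)
        (\<lambda>s. outputs s (encode (formula d)))"
      using triple_formula_prog[OF d] by (simp only:)
    show "\<exists>\<Psi>. encode (formula d) = encode \<Psi> \<and> good d \<Psi>" using good[OF d] by blast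
  qed
  then show ?thesis
    using good unfolding good_def Let_def by (intro exI[of _ 1700]) blast
qed

end
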